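(* Let $\rho\in\mathbb R$, let $\mathbf a=(a_{m,n})_{m,n=1}^\infty$ be a matrix with complex entries, and let $\kappa_{\mathbf a}:\mathbb H_\rho\times\mathbb H_\rho\to\mathbb C$ be the Dirichlet series kernel with coefficient matrix $\mathbf a$. Then the following statements are equivalent: (i) $\kappa_{\mathbf a}$ is $\mathrm{Aut}(\mathbb H_\rho)$-quasi-invariant with respect to some $\mathcal J$; (ii) $\kappa_{\mathbf a}$ is $\mathrm{Aut}_L(\mathbb H_\rho)$-quasi-invariant with respect to some $\mathcal J$; (iii) there exists a Dirichlet series $f:\mathbb H_\rho\to\mathbb C$ (convergent at every point of $\mathbb H_\rho$) such that $\kappa_{\mathbf a}(s,u)=f(s)\overline{f(u)}$ for all $s,u\in\mathbb H_\rho$, where $f$ is either identically zero or nowhere-vanishing on $\mathbb H_\rho$; (iv) $\kappa_{\mathbf a}$ is positive semi-definite and the reproducing kernel Hilbert space $\mathscr H_{\mathbf a}$ associated with $\kappa_{\mathbf a}$ is either $\{0\}$ or is spanned by a single nowhere-vanishing Dirichlet series on $\mathbb H_\rho$.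
   Context: For $\rho\in\mathbb R$, $\mathbb H_\rho=\{s\in\mathbb C:\Re(s)>\rho\}$. A double Dirichlet series $\sum_{m,n\ge1}c_{m,n}m^{-s}n^{-u}$ is regularly convergent at $(s_0,u_0)\in\mathbb C^2$ if the double series converges at $(s_0,u_0)$ and, for all integers $m,n\ge1$, the series $\sum_{m\ge1}c_{m,n}m^{-s_0}$ and $\sum_{n\ge1}c_{m,n}n^{-u_0}$ converge; it is regularly convergent on $\mathbb H_\rho\times\mathbb H_\rho$ if it is so at every point. For a complex matrix $\mathbf a=(a_{m,n})$, $\kappa_{\mathbf a}(s,u)=\sum_{m,n\ge1}a_{m,n}m^{-s}n^{-\bar u}$ is called a Dirichlet series kernel on $\mathbb H_\rho$ (with coefficient matrix $\mathbf a$) if the double Dirichlet series $(s,u)\mapsto\kappa_{\mathbf a}(s,\bar u)$ is regularly convergent on $\mathbb H_\rho\times\mathbb H_\rho$. A kernel $\kappa$ on a set $X$ is positive semi-definite if $(\kappa(x_i,x_j))_{i,j=1}^N$ is positive semi-definite for all finite $x_1,\dots,x_N\in X$. If $\kappa_{\mathbf a}$ is positive semi-definite, $\mathscr H_{\mathbf a}$ denotes the unique Hilbert space of functions on $\mathbb H_\rho$ containing $\kappa_{\mathbf a}(\cdot,t)$ for all $t\in\mathbb H_\rho$ with $\langle f,\kappa_{\mathbf a}(\cdot,t)\rangle=f(t)$ for all $f\in\mathscr H_{\mathbf a}$. For $A=\begin{pmatrix}a&b\\c&d\end{pmatrix}\in\mathrm{SL}_2(\mathbb R)$ let $\phi_A(s)=\frac{a(s-\rho)-ib}{ic(s-\rho)+d}+\rho$;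 then $\mathrm{Aut}(\mathbb H_\rho)=\{\phi_A:A\in\mathrm{SL}_2(\mathbb R)\}$ is the group of biholomorphic self-maps of $\mathbb H_\rho$, and $\mathrm{Aut}_L(\mathbb H_\rho)=\{\phi_A: A\in\mathrm{SL}_2(\mathbb R),\ c=0\}$. Quasi-invariance: Let $G$ be a group acting on a domain $\Omega$, let $\mathcal J:G\times\Omega\to\mathbb C$ be nowhere-vanishing with $\mathcal J(g,\cdot)$ holomorphic for each $g\in G$, and let $\kappa:\Omega\times\Omega\to\mathbb C$ be a positive semi-definite kernel. Then $\kappa$ is $G$-quasi-invariant with respect to $\mathcal J$ if $\mathcal J(g,s)\kappa(g\cdot s,g\cdot u)\overline{\mathcal J(g,u)}=\kappa(s,u)$ for all $s,u\in\Omega$, $g\in G$. *)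

theory Defs
  imports "HOL-Analysis.Analysis"
begin

definition halfplane :: "real \<Rightarrow> complex set" where
  "halfplane \<rho> = {s. Re s > \<rho>}"

definition double_sums :: "(nat \<Rightarrow> nat \<Rightarrow> complex) \<Rightarrow> complex \<Rightarrow> bool" where
  "double_sums c L \<longleftrightarrow>
     ((\<lambda>(M, N). \<Sum>m\<in>{1..M}. \<Sum>n\<in>{1..N}. c m n) \<longlongrightarrow> L) (sequentially \<times>\<^sub>F sequentially)"

definition double_sum :: "(nat \<Rightarrow> nat \<Rightarrow> complex) \<Rightarrow> complex" where
  "double_sum c = Lim (sequentially \<times>\<^sub>F sequentially)
                      (\<lambda>(M, N). \<Sum>m\<in>{1..M}. \<Sum>n\<in>{1..N}. c m n)"

definition dd_term :: "(nat \<Rightarrow> nat \<Rightarrow> complex) \<Rightarrow> complex \<Rightarrow> complex \<Rightarrow> nat \<Rightarrow> nat \<Rightarrow> complex" where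
  "dd_term c s u m n = c m n * of_nat m powr (- s) * of_nat n powr (- u)"

definition regularly_convergent_at ::
    "(nat \<Rightarrow> nat \<Rightarrow> complex) \<Rightarrow> complex \<Rightarrow> complex \<Rightarrow> bool" where
  "regularly_convergent_at c s0 u0 \<longleftrightarrow>
     (\<exists>L. double_sums (dd_term c s0 u0) L) \<and>
     (\<forall>n\<ge>1. summable (\<lambda>k. c (Suc k) n * of_nat (Suc k) powr (- s0))) \<and>
     (\<forall>m\<ge>1. summable (\<lambda>k. c m (Suc k) * of_nat (Suc k) powr (- u0)))"

definition ds_kernel :: "(nat \<Rightarrow> nat \<Rightarrow> complex) \<Rightarrow> complex \<Rightarrow> complex \<Rightarrow> complex" where
  "ds_kernel a s u = double_sum (dd_term a s (cnj u))"

text \<open>kappa_a is a Dirichlet series kernel on H_rho: (s,u) |-> kappa_a(s, conj u)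
  is regularly convergent on H_rho x H_rho.\<close>
definition is_ds_kernel_on :: "real \<Rightarrow> (nat \<Rightarrow> nat \<Rightarrow> complex) \<Rightarrow> bool" where
  "is_ds_kernel_on \<rho> a \<longleftrightarrow>
     (\<forall>s\<in>halfplane \<rho>. \<forall>u\<in>halfplane \<rho>. regularly_convergent_at a s u)"

definition psd_kernel :: "complex set \<Rightarrow> (complex \<Rightarrow> complex \<Rightarrow> complex) \<Rightarrow> bool" where
  "psd_kernel \<Omega> \<kappa> \<longleftrightarrow>
     (\<forall>(n::nat) (x::nat \<Rightarrow> complex) (c::nat \<Rightarrow> complex). (\<forall>i<n. x i \<in> \<Omega>) \<longrightarrow>
        Im (\<Sum>i<n. \<Sum>j<n. cnj (c i) * \<kappa> (x i) (x j) * c j) = 0 \<and>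
        Re (\<Sum>i<n. \<Sum>j<n. cnj (c i) * \<kappa> (x i) (x j) * c j) \<ge> 0)"

definition phi :: "real \<Rightarrow> real \<Rightarrow> real \<Rightarrow> real \<Rightarrow> real \<Rightarrow> complex \<Rightarrow> complex" where
  "phi \<rho> a b c d s =
     (of_real a * (s - of_real \<rho>) - \<i> * of_real b) /
     (\<i> * of_real c * (s - of_real \<rho>) + of_real d) + of_real \<rho>"

definition Aut_H :: "real \<Rightarrow> (complex \<Rightarrow> complex) set" where
  "Aut_H \<rho> = {phi \<rho> a b c d | a b c d. a * d - b * c = 1}"

definition Aut_L_H :: "real \<Rightarrow> (complex \<Rightarrow> complex) set" where
  "Aut_L_H \<rho> = {phi \<rho> a b c d | a b c d. a * d - b * c = 1 \<and> c = 0}"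

definition quasi_invariant ::
    "(complex \<Rightarrow> complex) set \<Rightarrow> complex set \<Rightarrow> ((complex \<Rightarrow> complex) \<Rightarrow> complex \<Rightarrow> complex)
     \<Rightarrow> (complex \<Rightarrow> complex \<Rightarrow> complex) \<Rightarrow> bool" where
  "quasi_invariant G \<Omega> J \<kappa> \<longleftrightarrow>
     psd_kernel \<Omega> \<kappa> \<and>
     (\<forall>g\<in>G. (\<forall>s\<in>\<Omega>. J g s \<noteq> 0) \<and> J g holomorphic_on \<Omega>) \<and>
     (\<forall>g\<in>G. \<forall>s\<in>\<Omega>. \<forall>u\<in>\<Omega>. J g s * \<kappa> (g s) (g u) * cnj (J g u) = \<kappa> s u)"

definition is_dirichlet_series_on :: "real \<Rightarrow> (complex \<Rightarrow> complex) \<Rightarrow> bool" where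
  "is_dirichlet_series_on \<rho> f \<longleftrightarrow>
     (\<exists>b::nat \<Rightarrow> complex. \<forall>s\<in>halfplane \<rho>.
        (\<lambda>k. b (Suc k) * of_nat (Suc k) powr (- s)) sums f s)"

text \<open>Functions on Omega are represented as functions on complex that vanish outside Omega.\<close>
definition restrict0 :: "complex set \<Rightarrow> (complex \<Rightarrow> complex) \<Rightarrow> complex \<Rightarrow> complex" where
  "restrict0 \<Omega> f = (\<lambda>s. if s \<in> \<Omega> then f s else 0)"

definition is_RKHS ::
    "complex set \<Rightarrow> (complex \<Rightarrow> complex \<Rightarrow> complex) \<Rightarrow> (complex \<Rightarrow> complex) set
     \<Rightarrow> ((complex \<Rightarrow> complex) \<Rightarrow> (complex \<Rightarrow> complex) \<Rightarrow> complex) \<Rightarrow> bool" where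
  "is_RKHS \<Omega> \<kappa> H ip \<longleftrightarrow>
     (\<forall>f\<in>H. \<forall>s. s \<notin> \<Omega> \<longrightarrow> f s = 0) \<and>
     (\<lambda>s. 0) \<in> H \<and>
     (\<forall>f\<in>H. \<forall>g\<in>H. (\<lambda>s. f s + g s) \<in> H) \<and>
     (\<forall>c. \<forall>f\<in>H. (\<lambda>s. c * f s) \<in> H) \<and>
     (\<forall>f\<in>H. \<forall>g\<in>H. \<forall>h\<in>H. ip (\<lambda>s. f s + g s) h = ip f h + ip g h) \<and>
     (\<forall>c. \<forall>f\<in>H. \<forall>g\<in>H. ip (\<lambda>s. c * f s) g = c * ip f g) \<and>
     (\<forall>f\<in>H. \<forall>g\<in>H. ip g f = cnj (ip f g)) \<and>
     (\<forall>f\<in>H. Im (ip f f) = 0 \<and> Re (ip f f) \<ge> 0 \<and> (ip f f = 0 \<longrightarrow> f = (\<lambda>s. 0))) \<and>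
     (\<forall>F::nat \<Rightarrow> complex \<Rightarrow> complex. (\<forall>k. F k \<in> H) \<longrightarrow>
        (\<forall>e>0. \<exists>N. \<forall>m\<ge>N. \<forall>n\<ge>N.
            sqrt (Re (ip (\<lambda>s. F m s - F n s) (\<lambda>s. F m s - F n s))) < e) \<longrightarrow>
        (\<exists>f\<in>H. (\<lambda>n. sqrt (Re (ip (\<lambda>s. F n s - f s) (\<lambda>s. F n s - f s))))
                    \<longlonglongrightarrow> 0)) \<and>
     (\<forall>t\<in>\<Omega>. restrict0 \<Omega> (\<lambda>s. \<kappa> s t) \<in> H) \<and>
     (\<forall>f\<in>H. \<forall>t\<in>\<Omega>. ip f (restrict0 \<Omega> (\<lambda>s. \<kappa> s t)) = f t)"

end

theory Submission
  imports Defs "HOL-Complex_Analysis.Cauchy_Integral_Formula"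
begin

text \<open>
  The heart of the matter is that quasi-invariance under the dilations of the half-plane already
  forces rank one. The ratio \<open>|\<kappa>(s,u)|\<^sup>2 / (\<kappa>(s,s) \<kappa>(u,u))\<close> is invariant under
  dilations. If \<open>m\<close> is the least index whose row or column of coefficients is nonzero, then
  positivity forces \<open>a\<^sub>m\<^sub>m \<noteq> 0\<close>, and \<open>\<kappa>(s,u)\<close> behaves like its leading term
  \<open>a\<^sub>m\<^sub>m m\<^bsup>-s-cnj u\<^esup>\<close> as the real parts of \<open>s\<close> and \<open>u\<close> tend to infinity, so the ratio tends to 1
  along the dilations and is therefore identically 1. Equality in the Cauchy--Schwarz inequality makes
  \<open>\<kappa>\<close> a rank one kernel. Conversely, for \<open>\<kappa>(s,u) = f(s) cnj (f(u))\<close> with \<open>f\<close> nowhere vanishing,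
  \<open>J(g,s) = f(s) / f(g s)\<close> is a holomorphic cocycle.
\<close>

lemma norm_of_nat_powr: "n \<ge> 1 \<Longrightarrow> norm ((of_nat n :: complex) powr z) = real n powr Re z"
  by (subst norm_powr_real_powr) auto

subsection \<open>Positive semi-definite kernels\<close>

lemma psd_kernel_diag:
  assumes "psd_kernel \<Omega> \<kappa>" and "s \<in> \<Omega>"
  shows "\<kappa> s s = of_real (Re (\<kappa> s s))" and "Re (\<kappa> s s) \<ge> 0"
  using assms(1)[unfolded psd_kernel_def, rule_format, of 1 "\<lambda>_. s" "\<lambda>_. 1"] assms(2)
  by (auto simp: complex_eq_iff)

lemma psd_kernel_two_points:
  assumes "psd_kernel \<Omega> \<kappa>" and "s \<in> \<Omega>" "u \<in> \<Omega>"
  shows "Im (cnj \<alpha> * \<kappa> s s * \<alpha> + cnj \<alpha> * \<kappa> s u * \<beta> + cnj \<beta> * \<kappa> u s * \<alpha> + cnj \<beta> * \<kappa> u u * \<beta>) = 0"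
    and "Re (cnj \<alpha> * \<kappa> s s * \<alpha> + cnj \<alpha> * \<kappa> s u * \<beta> + cnj \<beta> * \<kappa> u s * \<alpha> + cnj \<beta> * \<kappa> u u * \<beta>) \<ge> 0"
proof -
  define x where "x = (\<lambda>i::nat. if i = 0 then s else u)"
  define c where "c = (\<lambda>i::nat. if i = 0 then \<alpha> else \<beta>)"
  have "(\<Sum>i<2. \<Sum>j<2. cnj (c i) * \<kappa> (x i) (x j) * c j) =
     cnj \<alpha> * \<kappa> s s * \<alpha> + cnj \<alpha> * \<kappa> s u * \<beta> + cnj \<beta> * \<kappa> u s * \<alpha> + cnj \<beta> * \<kappa> u u * \<beta>"
    by (simp add: numeral_2_eq_2 x_def c_def)
  moreover have "\<forall>i<2. x i \<in> \<Omega>" using assms by (auto simp: x_def)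
  ultimately show "Im (cnj \<alpha> * \<kappa> s s * \<alpha> + cnj \<alpha> * \<kappa> s u * \<beta> + cnj \<beta> * \<kappa> u s * \<alpha> + cnj \<beta> * \<kappa> u u * \<beta>) = 0"
    and "Re (cnj \<alpha> * \<kappa> s s * \<alpha> + cnj \<alpha> * \<kappa> s u * \<beta> + cnj \<beta> * \<kappa> u s * \<alpha> + cnj \<beta> * \<kappa> u u * \<beta>) \<ge> 0"
    using assms(1)[unfolded psd_kernel_def, rule_format, of 2 x c] by auto
qed

text \<open>Reality of the quadratic form at the vector (1, 1) makes the imaginary parts of
  \<open>\<kappa> s u\<close> and \<open>\<kappa> u s\<close> opposite; at (1, i) it makes their
  real parts equal.\<close>

lemma psd_kernel_hermitian:
  assumes "psd_kernel \<Omega> \<kappa>" and "s \<in> \<Omega>" "u \<in> \<Omega>"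
  shows "\<kappa> u s = cnj (\<kappa> s u)"
proof -
  have "Im (\<kappa> s s) = 0" "Im (\<kappa> u u) = 0"
    using psd_kernel_diag(1)[OF assms(1)] assms(2,3) by (metis Im_complex_of_real)+
  with psd_kernel_two_points(1)[OF assms, of 1 1] psd_kernel_two_points(1)[OF assms, of 1 \<i>]
  show ?thesis by (simp add: complex_eq_iff)
qed

text \<open>The form is tested on vectors \<open>(x, - r * cnj k)\<close>: the phase of the second
  entry turns both cross terms into \<open>- x * r\<close> times the squared modulus of
  \<open>k\<close>.\<close>

lemma psd_kernel_Cauchy_Schwarz:
  assumes psd: "psd_kernel \<Omega> \<kappa>" and s: "s \<in> \<Omega>" and u: "u \<in> \<Omega>"
  shows "(norm (\<kappa> s u))\<^sup>2 \<le> norm (\<kappa> s s) * norm (\<kappa> u u)"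
proof -
  define p q k where "p = Re (\<kappa> s s)" and "q = Re (\<kappa> u u)" and "k = \<kappa> s u"
  have diag: "\<kappa> s s = of_real p" "\<kappa> u u = of_real q" and nonneg: "p \<ge> 0" "q \<ge> 0"
    unfolding p_def q_def using psd_kernel_diag[OF psd] s u by blast+
  have sym: "\<kappa> u s = cnj k" unfolding k_def using psd_kernel_hermitian[OF psd s u] .
  have form: "x\<^sup>2 * p - 2 * x * r * (norm k)\<^sup>2 + r\<^sup>2 * (norm k)\<^sup>2 * q \<ge> 0" for x r :: real
    using psd_kernel_two_points(2)[OF psd s u, of "of_real x" "- of_real r * cnj k"]
    unfolding cmod_power2 by (simp add: diag sym k_def[symmetric] power2_eq_square algebra_simps)
  have "(norm k)\<^sup>2 \<le> p * q"
  proof (cases "q = 0")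
    case True
    have "(norm k)\<^sup>2 = 0"
    proof (rule ccontr)
      assume "(norm k)\<^sup>2 \<noteq> 0"
      \<comment> \<open>For \<open>q = 0\<close> the form is affine in \<open>r\<close>, and this
        \<open>r\<close> gives it the value -1.\<close>
      with form[of 1 "(p + 1) / (2 * (norm k)\<^sup>2)"] True show False
        by (simp add: field_simps)
    qed
    then show ?thesis using nonneg by simp
  next
    case False
    \<comment> \<open>At fixed \<open>x\<close> the form is smallest at \<open>r = x / q\<close>;
      taking \<open>x = q\<close> clears the denominator.\<close>
    have "q * (p * q - (norm k)\<^sup>2) \<ge> 0"
      using form[of q 1] by (simp add: power2_eq_square algebra_simps)
    with False nonneg show ?thesis by (simp add: zero_le_mult_iff)
  qed
  then show ?thesis using nonneg by (simp add: diag k_def)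
qed

text \<open>Seen as a Gram matrix, equality in Cauchy-Schwarz against \<open>v\<close> makes every
  vector a multiple of the one at \<open>v\<close>, so all are parallel. In place of a feature
  space, the proof uses positivity at the three points \<open>s\<close>, \<open>u\<close>,
  \<open>v\<close>.\<close>

lemma psd_kernel_rank_one:
  assumes psd: "psd_kernel \<Omega> \<kappa>" and s: "s \<in> \<Omega>" and u: "u \<in> \<Omega>" and v: "v \<in> \<Omega>"
    and nz: "\<kappa> v v \<noteq> 0"
    and eq: "\<And>w. w \<in> \<Omega> \<Longrightarrow> (norm (\<kappa> w v))\<^sup>2 = norm (\<kappa> w w) * norm (\<kappa> v v)"
  shows "\<kappa> s u * \<kappa> v v = \<kappa> s v * \<kappa> v u"
proof -
  define N p q k where "N = Re (\<kappa> v v)" and "p = \<kappa> s v" and "q = \<kappa> u v" and "k = \<kappa> s u"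
  have vv: "\<kappa> v v = of_real N" unfolding N_def using psd_kernel_diag[OF psd v] by blast
  have N: "N > 0" using psd_kernel_diag(2)[OF psd v] nz vv unfolding N_def[symmetric]
    by (cases "N = 0") auto
  have diag: "\<kappa> w w = \<kappa> w v * cnj (\<kappa> w v) / of_real N" if w: "w \<in> \<Omega>" for w
  proof -
    have "of_real (norm (\<kappa> w w)) = \<kappa> w w"
      using psd_kernel_diag[OF psd w] by (metis abs_of_nonneg norm_of_real)
    moreover have "norm (\<kappa> w w) = (norm (\<kappa> w v))\<^sup>2 / N" using eq[OF w] N vv by simp
    ultimately show ?thesis by (metis complex_norm_square of_real_divide)
  qed
  have ss: "\<kappa> s s = p * cnj p / of_real N" and uu: "\<kappa> u u = q * cnj q / of_real N"
    using diag s u by (auto simp: p_def q_def)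
  have sym: "\<kappa> u s = cnj k" "\<kappa> v s = cnj p" "\<kappa> v u = cnj q"
    unfolding k_def p_def q_def by (rule psd_kernel_hermitian[OF psd]; fact)+
  \<comment> \<open>The coefficient \<open>\<gamma>\<close> at \<open>v\<close> is chosen to kill the square in the quadratic form, which leaves the
    Schur complement; its diagonal is zero, so only the entry \<open>X\<close> contributes.\<close>
  define X where "X = k - p * cnj q / of_real N"
  define \<beta> \<gamma> where "\<beta> = - cnj X" and "\<gamma> = - (cnj p + cnj q * \<beta>) / of_real N"
  define x where "x = (\<lambda>i::nat. if i = 0 then s else if i = 1 then u else v)"
  define c where "c = (\<lambda>i::nat. if i = 0 then 1 else if i = 1 then \<beta> else \<gamma>)"
  have "(\<Sum>i<3. \<Sum>j<3. cnj (c i) * \<kappa> (x i) (x j) * c j) =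
     \<kappa> s s + k * \<beta> + p * \<gamma> + cnj \<beta> * (cnj k + \<kappa> u u * \<beta> + q * \<gamma>) +
     cnj \<gamma> * (cnj p + cnj q * \<beta> + of_real N * \<gamma>)"
    by (simp add: numeral_3_eq_3 x_def c_def sym vv k_def[symmetric] p_def[symmetric]
        q_def[symmetric] algebra_simps)
  also have "cnj p + cnj q * \<beta> + of_real N * \<gamma> = 0" using N by (simp add: \<gamma>_def)
  also have "\<kappa> s s + k * \<beta> + p * \<gamma> + cnj \<beta> * (cnj k + \<kappa> u u * \<beta> + q * \<gamma>) + cnj \<gamma> * 0 =
      X * \<beta> + cnj (X * \<beta>)"
    unfolding X_def \<gamma>_def ss uu using N by (simp add: field_simps)
  \<comment> \<open>The choice \<open>\<beta> = - cnj X\<close> aligns the phase, so the form is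
    negative unless \<open>X = 0\<close>.\<close>
  also have "\<dots> = - of_real (2 * (norm X)\<^sup>2)"
    unfolding \<beta>_def of_real_mult complex_norm_square by simp
  finally have "Re (- of_real (2 * (norm X)\<^sup>2)) \<ge> 0"
    using psd[unfolded psd_kernel_def, rule_format, of 3 x c] s u v by (auto simp: x_def)
  then have "X = 0" by simp
  then show ?thesis using N by (simp add: X_def k_def p_def[symmetric] sym vv field_simps)
qed

lemma psd_kernel_rank_one_form:
  assumes "\<And>s u. s \<in> \<Omega> \<Longrightarrow> u \<in> \<Omega> \<Longrightarrow> \<kappa> s u = f s * cnj (f u)"
  shows "psd_kernel \<Omega> \<kappa>"
  unfolding psd_kernel_def
proof (intro allI impI)
  fix n :: nat and x c :: "nat \<Rightarrow> complex"
  assume x: "\<forall>i<n. x i \<in> \<Omega>"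
  have "(\<Sum>i<n. \<Sum>j<n. cnj (c i) * \<kappa> (x i) (x j) * c j) =
        (\<Sum>i<n. \<Sum>j<n. (cnj (c i) * f (x i)) * cnj (cnj (c j) * f (x j)))"
    using x by (intro sum.cong) (auto simp: assms)
  also have "\<dots> = (\<Sum>i<n. cnj (c i) * f (x i)) * cnj (\<Sum>i<n. cnj (c i) * f (x i))"
    by (simp only: sum_product cnj_sum)
  also have "\<dots> = of_real ((norm (\<Sum>i<n. cnj (c i) * f (x i)))\<^sup>2)"
    by (simp only: complex_norm_square)
  finally show "Im (\<Sum>i<n. \<Sum>j<n. cnj (c i) * \<kappa> (x i) (x j) * c j) = 0 \<and>
        Re (\<Sum>i<n. \<Sum>j<n. cnj (c i) * \<kappa> (x i) (x j) * c j) \<ge> 0"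
    by simp
qed

subsection \<open>Automorphisms of the half-plane\<close>

text \<open>Multiplying by the conjugate denominator gives
  \<open>Re (phi \<rho> a b c d s) - \<rho>\<close> as the determinant times
  \<open>Re s - \<rho>\<close> over the squared modulus of the denominator, as for the usual action
  on the upper half-plane.\<close>

lemma phi_halfplane:
  assumes det: "a * d - b * c = 1" and s: "s \<in> halfplane \<rho>"
  shows "\<i> * of_real c * (s - of_real \<rho>) + of_real d \<noteq> 0" (is "?D \<noteq> 0")
    and "phi \<rho> a b c d s \<in> halfplane \<rho>"
proof -
  have pos: "Re s > \<rho>" using s by (simp add: halfplane_def)
  show D: "?D \<noteq> 0"
  proof
    assume D0: "?D = 0"
    \<comment> \<open>This is the imaginary part of the denominator.\<close>
    then have "c * (Re s - \<rho>) = 0" by (simp add: complex_eq_iff)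
    then have "c = 0" using pos by simp
    with D0 det show False by simp
  qed
  let ?A = "of_real a * (s - of_real \<rho>) - \<i> * of_real b"
  have "Re (?A / ?D) = Re (?A * cnj ?D) / (norm ?D)\<^sup>2"
    by (simp add: complex_div_cnj[of ?A] Re_divide_of_real flip: of_real_power)
  also have "Re (?A * cnj ?D) = (a * d - b * c) * (Re s - \<rho>)"
    by (simp add: algebra_simps)
  also have "\<dots> / (norm ?D)\<^sup>2 > 0" using pos D det by simp
  finally show "phi \<rho> a b c d s \<in> halfplane \<rho>"
    by (simp add: halfplane_def phi_def)
qed

lemma phi_holomorphic_on:
  assumes "a * d - b * c = 1"
  shows "phi \<rho> a b c d holomorphic_on halfplane \<rho>"
  unfolding phi_def[abs_def] using phi_halfplane(1)[OF assms]
  by (intro holomorphic_intros) auto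

text \<open>Dilations about the boundary point \<open>\<rho>\<close> push every point of the
  half-plane to infinite real part, where leading terms dominate. The passage from invariance to
  rank one runs along these maps.\<close>

lemma phi_dilation_in_Aut_L_H:
  assumes "t > 0"
  shows "(\<lambda>s. of_real \<rho> + of_real t * (s - of_real \<rho>)) \<in> Aut_L_H \<rho>"
proof -
  have "phi \<rho> (sqrt t) 0 0 (1 / sqrt t) = (\<lambda>s. of_real \<rho> + of_real t * (s - of_real \<rho>))"
    using assms by (auto simp: phi_def fun_eq_iff simp flip: of_real_mult)
  moreover have "sqrt t * (1 / sqrt t) - 0 * 0 = 1" using assms by simp
  ultimately show ?thesis
    unfolding Aut_L_H_def mem_Collect_eq
    by (intro exI[of _ "sqrt t"] exI[of _ 0] exI[of _ "1 / sqrt t"]) simp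
qed

subsection \<open>Holomorphy of Dirichlet series\<close>

text \<open>Mean value inequality on the segment from \<open>n + 1\<close> to \<open>n\<close>,
  where the derivative is largest at \<open>n\<close>. The extra factor 1/n is what makes a series
  absolutely convergent after summation by parts.\<close>

lemma norm_powr_diff_Suc_le:
  assumes n: "n \<ge> 1" and z: "Re z > 0"
  shows "norm ((of_nat n :: complex) powr (-z) - of_nat (Suc n) powr (-z))
           \<le> norm z * real n powr (- Re z - 1)"
proof -
  let ?S = "closed_segment (of_nat (Suc n) :: complex) (of_nat n)"
  have S: "\<exists>r\<ge>real n. w = of_real r" if w: "w \<in> ?S" for w
  proof -
    obtain t where t: "0 \<le> t" "t \<le> 1"
      "w = (1 - t) *\<^sub>R of_nat (Suc n) + t *\<^sub>R of_nat n"
      using w unfolding closed_segment_def by blast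
    have "w = of_real (real n + (1 - t))"
      using t(3) by (simp add: scaleR_conv_of_real algebra_simps)
    then show ?thesis using t(2) by (metis add_increasing2 diff_ge_0_iff_ge order_refl)
  qed
  have "norm ((of_nat n :: complex) powr (-z) - of_nat (Suc n) powr (-z))
        \<le> (norm z * real n powr (- Re z - 1)) * norm (of_nat n - (of_nat (Suc n) :: complex))"
  proof (rule field_differentiable_bound[where S = ?S and f' = "\<lambda>w. - z * w powr (- z - 1)"])
    fix w assume "w \<in> ?S"
    then obtain r where r: "r \<ge> real n" "w = of_real r" using S by blast
    have "w \<notin> \<real>\<^sub>\<le>\<^sub>0" using r n by simp
    then show "((\<lambda>w. w powr (-z)) has_field_derivative - z * w powr (- z - 1)) (at w within ?S)"
      by (rule has_field_derivative_at_within[OF has_field_derivative_powr])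
    have "norm (w powr (- z - 1)) = r powr (- Re z - 1)"
      using r n by (subst norm_powr_real_powr) auto
    also have "\<dots> \<le> real n powr (- Re z - 1)"
      using r n z by (intro powr_mono2') auto
    finally show "norm (- z * w powr (- z - 1)) \<le> norm z * real n powr (- Re z - 1)"
      by (simp add: norm_mult mult_left_mono)
  qed auto
  then show ?thesis by (simp add: norm_minus_commute)
qed

lemma open_halfplane: "open (halfplane \<rho>)"
  by (simp add: halfplane_def open_halfspace_Re_gt)

lemma summable_Suc_powr: "p < -1 \<Longrightarrow> summable (\<lambda>k. real (Suc k) powr p)"
  using summable_real_powr_iff[of p] summable_Suc_iff[of "\<lambda>n. real n powr p"] by simp

lemma is_dirichlet_series_on_holomorphic:
  assumes "is_dirichlet_series_on \<rho> f"
  shows "f holomorphic_on halfplane \<rho>"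
proof -
  obtain b where b: "\<And>s. s \<in> halfplane \<rho> \<Longrightarrow>
      (\<lambda>k. b (Suc k) * of_nat (Suc k) powr (- s)) sums f s"
    using assms by (auto simp: is_dirichlet_series_on_def)
  have "f field_differentiable (at s1)" if s1: "s1 \<in> halfplane \<rho>" for s1
  proof -
    \<comment> \<open>Halfway between the boundary and \<open>s1\<close>: the series converges at
      \<open>s0\<close>, and \<open>s1\<close> lies strictly to the right of it.\<close>
    define \<sigma> where "\<sigma> = (\<rho> + Re s1) / 2"
    define s0 :: complex where "s0 = of_real \<sigma>"
    have \<sigma>: "\<rho> < \<sigma>" "\<sigma> < Re s1" using s1 by (auto simp: \<sigma>_def halfplane_def)
    \<comment> \<open>The series may converge only conditionally; Abel summation against its partial sums at \<open>s0\<close>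
      gives a locally uniformly absolutely convergent series.\<close>
    define P where "P = (\<lambda>n. \<Sum>k<n. b (Suc k) * of_nat (Suc k) powr (- s0))"
    have "convergent P"
      using b[of s0] \<sigma> unfolding P_def s0_def halfplane_def
      by (auto simp: sums_def convergent_def)
    then obtain C where C: "\<And>n. norm (P n) \<le> C"
      by (meson Bseq_def convergent_imp_Bseq)
    have C0: "C \<ge> 0" using C[of 0] norm_ge_zero order_trans by blast
    define g where "g = (\<lambda>k s. P (Suc k) *
        ((of_nat (Suc k) :: complex) powr (- (s - s0)) - of_nat (Suc (Suc k)) powr (- (s - s0))))"
    have g_bound: "norm (g k s) \<le> C * (norm (s - s0) * real (Suc k) powr (- Re (s - s0) - 1))"
      if "s \<in> halfplane \<sigma>" for k s
      unfolding g_def norm_mult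
      using that by (intro mult_mono C norm_powr_diff_Suc_le C0) (auto simp: s0_def halfplane_def)
    have "\<exists>G. \<forall>s\<in>halfplane \<sigma>. (\<lambda>k. g k s) sums G s \<and> G field_differentiable (at s)"
    proof (rule series_differentiable_comparison_complex[of "halfplane \<sigma>" g])
      show "open (halfplane \<sigma>)" by (rule open_halfplane)
      show "g k field_differentiable (at s)" for k s
      proof (rule holomorphic_on_imp_differentiable_at[OF _ open_UNIV])
        show "g k holomorphic_on UNIV" unfolding g_def
          by (intro holomorphic_intros) (auto simp flip: of_nat_Suc)
      qed simp
      fix x assume x: "x \<in> halfplane \<sigma>"
      \<comment> \<open>With half the distance to the boundary as radius, the ball around
        \<open>x\<close> stays at real part at least \<open>\<sigma> + d\<close>, so one exponent
        serves the whole ball.\<close>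
      define d where "d = (Re x - \<sigma>) / 2"
      have d: "d > 0" using x by (simp add: d_def halfplane_def)
      define R where "R = norm (x - s0) + d"
      define h where "h = (\<lambda>k. complex_of_real (C * (R * real (Suc k) powr (- d - 1))))"
      have R: "R \<ge> 0" using d by (simp add: R_def)
      have "summable h" unfolding h_def
        using d by (intro summable_of_real summable_mult summable_Suc_powr) auto
      moreover have "range h \<subseteq> \<real>\<^sub>\<ge>\<^sub>0"
        using C0 R by (auto simp: h_def simp del: of_real_mult)
      moreover have "norm (g k y) \<le> norm (h k)" if y: "y \<in> ball x d \<inter> halfplane \<sigma>" for k y
      proof -
        have yx: "norm (x - y) < d" using y by (simp add: dist_norm)
        have "Re (x - y) < d" using yx complex_Re_le_cmod[of "x - y"] by linarith
        then have Re: "Re (y - s0) \<ge> d" by (simp add: d_def s0_def field_simps)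
        have "norm (y - s0) \<le> norm (x - s0) + norm (x - y)"
          by (metis norm_minus_commute norm_triangle_sub add.commute diff_add_cancel norm_triangle_ineq
              add_diff_eq diff_diff_eq2)
        then have nrm: "norm (y - s0) \<le> R" using yx by (simp add: R_def)
        have "norm (g k y) \<le> C * (norm (y - s0) * real (Suc k) powr (- Re (y - s0) - 1))"
          using g_bound y by blast
        also have "\<dots> \<le> C * (R * real (Suc k) powr (- d - 1))"
          using Re nrm R C0 by (intro mult_left_mono mult_mono powr_mono) auto
        also have "\<dots> = norm (h k)" unfolding h_def norm_of_real using C0 R by simp
        finally show ?thesis .
      qed
      ultimately show "\<exists>d h. 0 < d \<and> summable h \<and> range h \<subseteq> \<real>\<^sub>\<ge>\<^sub>0 \<and>
          (\<forall>\<^sub>F n in sequentially. \<forall>y\<in>ball x d \<inter> halfplane \<sigma>. norm (g n y) \<le> cmod (h n))"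
        using d by (intro exI[of _ d] exI[of _ h]) auto
    qed blast
    then obtain G where G: "\<And>s. s \<in> halfplane \<sigma> \<Longrightarrow> (\<lambda>k. g k s) sums G s"
      and Gd: "\<And>s. s \<in> halfplane \<sigma> \<Longrightarrow> G field_differentiable (at s)"
      by blast
    have f_eq: "f s = G s" if s: "s \<in> halfplane \<sigma>" for s
    proof -
      have x: "Re (s - s0) > 0" using s by (simp add: s0_def halfplane_def)
      \<comment> \<open>Summation by parts; the boundary term vanishes in the limit because
        \<open>P\<close> is bounded and \<open>Re (s - s0) > 0\<close>.\<close>
      have abel: "(\<Sum>k<n. b (Suc k) * of_nat (Suc k) powr (- s)) =
          P n * of_nat (Suc n) powr (- (s - s0)) + (\<Sum>k<n. g k s)" for n
      proof (induction n)
        case 0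
        then show ?case by (simp add: P_def)
      next
        case (Suc n)
        have "b (Suc n) * of_nat (Suc n) powr (- s) =
              (P (Suc n) - P n) * of_nat (Suc n) powr (- (s - s0))"
          by (simp add: P_def powr_add[symmetric] mult.assoc)
        with Suc show ?case by (simp add: g_def algebra_simps)
      qed
      have "(\<lambda>n. P n * of_nat (Suc n) powr (- (s - s0))) \<longlonglongrightarrow> 0"
      proof (rule Lim_null_comparison)
        show "\<forall>\<^sub>F n in sequentially. norm (P n * of_nat (Suc n) powr (- (s - s0)))
            \<le> C * real (Suc n) powr (- Re (s - s0))"
          unfolding norm_mult by (intro always_eventually allI mult_mono C C0)
            (simp_all add: norm_of_nat_powr del: of_nat_Suc)
        have "(\<lambda>n. real (Suc n) powr (- Re (s - s0))) \<longlonglongrightarrow> 0"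
          using x filterlim_Suc by (intro tendsto_neg_powr filterlim_compose[OF filterlim_real_sequentially]) auto
        then show "(\<lambda>n. C * real (Suc n) powr (- Re (s - s0))) \<longlonglongrightarrow> 0"
          by (rule tendsto_mult_right_zero)
      qed
      from tendsto_add[OF this G[OF s, unfolded sums_def]]
      have "(\<lambda>n. \<Sum>k<n. b (Suc k) * of_nat (Suc k) powr (- s)) \<longlonglongrightarrow> G s"
        by (simp only: abel[symmetric] add_0)
      moreover have "s \<in> halfplane \<rho>" using s \<sigma> by (simp add: halfplane_def)
      ultimately show ?thesis using b[of s] unfolding sums_def
        using LIMSEQ_unique by blast
    qed
    have s1': "s1 \<in> halfplane \<sigma>" using \<sigma> by (simp add: halfplane_def)
    from Gd[OF s1'] obtain G' where "(G has_field_derivative G') (at s1)"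
      by (auto simp: field_differentiable_def)
    then have "(f has_field_derivative G') (at s1)"
      by (rule has_field_derivative_transform_within_open[OF _ open_halfplane s1']) (simp add: f_eq)
    then show ?thesis by (auto simp: field_differentiable_def)
  qed
  then show ?thesis
    by (auto simp: holomorphic_on_def intro: field_differentiable_at_within)
qed

section \<open>From rank one to quasi-invariance\<close>

lemma quasi_invariant_Aut_H_rank_one:
  assumes ds: "is_dirichlet_series_on \<rho> f"
    and eq: "\<forall>s\<in>halfplane \<rho>. \<forall>u\<in>halfplane \<rho>. \<kappa> s u = f s * cnj (f u)"
    and f: "(\<forall>s\<in>halfplane \<rho>. f s = 0) \<or> (\<forall>s\<in>halfplane \<rho>. f s \<noteq> 0)"
  shows "\<exists>J. quasi_invariant (Aut_H \<rho>) (halfplane \<rho>) J \<kappa>"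
proof -
  have psd: "psd_kernel (halfplane \<rho>) \<kappa>"
    using eq by (intro psd_kernel_rank_one_form[of _ _ f]) auto
  have G: "g s \<in> halfplane \<rho>" if "g \<in> Aut_H \<rho>" "s \<in> halfplane \<rho>" for g s
    using that phi_halfplane(2) by (auto simp: Aut_H_def)
  have Gh: "g holomorphic_on halfplane \<rho>" if "g \<in> Aut_H \<rho>" for g
    using that phi_holomorphic_on by (auto simp: Aut_H_def)
  from f show ?thesis
  proof
    assume "\<forall>s\<in>halfplane \<rho>. f s = 0"
    \<comment> \<open>For the zero kernel the quotient of values of \<open>f\<close> is meaningless,
      but the constant cocycle 1 works.\<close>
    then have "quasi_invariant (Aut_H \<rho>) (halfplane \<rho>) (\<lambda>_ _. 1) \<kappa>"
      using psd eq G by (auto simp: quasi_invariant_def)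
    then show ?thesis by blast
  next
    assume nz: "\<forall>s\<in>halfplane \<rho>. f s \<noteq> 0"
    have "(\<lambda>s. f s / f (g s)) holomorphic_on halfplane \<rho>" if g: "g \<in> Aut_H \<rho>" for g
    proof (intro holomorphic_on_divide)
      show "f holomorphic_on halfplane \<rho>" by (rule is_dirichlet_series_on_holomorphic[OF ds])
      then show "(\<lambda>s. f (g s)) holomorphic_on halfplane \<rho>"
        using holomorphic_on_compose_gen[OF Gh[OF g], of f "halfplane \<rho>"] G[OF g]
        by (auto simp: o_def image_subset_iff)
    qed (use nz G g in auto)
    then have "quasi_invariant (Aut_H \<rho>) (halfplane \<rho>) (\<lambda>g s. f s / f (g s)) \<kappa>"
      using psd eq G nz by (auto simp: quasi_invariant_def)
    then show ?thesis by blast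
  qed
qed

subsection \<open>One-dimensional reproducing kernel Hilbert spaces\<close>

lemma is_RKHS_zero:
  assumes "\<forall>s\<in>\<Omega>. \<forall>u\<in>\<Omega>. \<kappa> s u = 0"
  shows "is_RKHS \<Omega> \<kappa> {\<lambda>s. 0} (\<lambda>_ _. 0)"
  using assms unfolding is_RKHS_def by (auto simp: restrict0_def fun_eq_iff)

text \<open>The kernel section at \<open>t\<close> is \<open>cnj (f t)\<close> times
  \<open>f\<close>, so reproduction forces \<open>f\<close> to have norm 1 and two multiples of
  \<open>f\<close> to pair as their coefficients do. The coefficient of \<open>h\<close> is read off
  at the base point as \<open>h p / f p\<close>, which gives this formula for the inner
  product.\<close>

lemma is_RKHS_rank_one:
  assumes eq: "\<forall>s\<in>\<Omega>. \<forall>u\<in>\<Omega>. \<kappa> s u = f s * cnj (f u)" and p: "p \<in> \<Omega>" "f p \<noteq> 0"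
  shows "is_RKHS \<Omega> \<kappa> {restrict0 \<Omega> (\<lambda>s. c * f s) | c. True}
           (\<lambda>h k. h p * cnj (k p) / of_real ((norm (f p))\<^sup>2))"
    (is "is_RKHS _ _ ?H ?ip")
proof -
  have ip_self: "z * cnj z / of_real ((norm (f p))\<^sup>2) =
      complex_of_real ((norm z)\<^sup>2 / (norm (f p))\<^sup>2)" for z
    by (simp only: of_real_divide complex_norm_square)
  have norm_ip: "sqrt (Re (z * cnj z / of_real ((norm (f p))\<^sup>2))) = norm z / norm (f p)" for z
    by (simp only: ip_self Re_complex_of_real real_sqrt_divide real_sqrt_abs abs_norm_cancel)
  have mem: "restrict0 \<Omega> (\<lambda>s. c * f s) \<in> ?H" for c by blast
  have complete: "\<exists>h\<in>?H. (\<lambda>n. sqrt (Re (?ip (\<lambda>s. F n s - h s) (\<lambda>s. F n s - h s)))) \<longlonglongrightarrow> 0"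
    if F: "\<forall>k. F k \<in> ?H" and
      cauchy: "\<forall>e>0. \<exists>N. \<forall>m\<ge>N. \<forall>n\<ge>N.
            sqrt (Re (?ip (\<lambda>s. F m s - F n s) (\<lambda>s. F m s - F n s))) < e"
    for F :: "nat \<Rightarrow> complex \<Rightarrow> complex"
  proof -
    \<comment> \<open>The norm of an element is the modulus of its coefficient, so completeness is
      that of the complex plane.\<close>
    have "Cauchy (\<lambda>n. F n p / f p)"
      unfolding Cauchy_def dist_norm diff_divide_distrib[symmetric] norm_divide
      using cauchy unfolding norm_ip by auto
    then obtain l where l: "(\<lambda>n. F n p / f p) \<longlonglongrightarrow> l"
      using Cauchy_convergent convergent_def by blast
    have "(\<lambda>n. norm (F n p / f p - l)) \<longlonglongrightarrow> 0"
      using l by (simp add: LIM_zero tendsto_norm_zero)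
    moreover have "norm (F n p / f p - l) = norm (F n p - l * f p) / norm (f p)" for n
      using p by (simp add: field_simps flip: norm_divide)
    ultimately show ?thesis
      unfolding norm_ip using p
      by (intro bexI[OF _ mem[of l]]) (simp add: restrict0_def)
  qed
  have add: "(\<lambda>s. h s + k s) \<in> ?H" if "h \<in> ?H" "k \<in> ?H" for h k
  proof -
    obtain c d where "h = restrict0 \<Omega> (\<lambda>s. c * f s)" "k = restrict0 \<Omega> (\<lambda>s. d * f s)"
      using \<open>h \<in> ?H\<close> \<open>k \<in> ?H\<close> by blast
    then have "(\<lambda>s. h s + k s) = restrict0 \<Omega> (\<lambda>s. (c + d) * f s)"
      by (auto simp: restrict0_def fun_eq_iff algebra_simps)
    then show ?thesis by blast
  qed
  have scale: "(\<lambda>s. c * h s) \<in> ?H" if "h \<in> ?H" for h c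
  proof -
    obtain d where "h = restrict0 \<Omega> (\<lambda>s. d * f s)" using \<open>h \<in> ?H\<close> by blast
    then have "(\<lambda>s. c * h s) = restrict0 \<Omega> (\<lambda>s. (c * d) * f s)"
      by (auto simp: restrict0_def fun_eq_iff)
    then show ?thesis by blast
  qed
  have zero: "(\<lambda>s. 0) \<in> ?H"
    using mem[of 0] by (simp add: restrict0_def)
  have kernel: "restrict0 \<Omega> (\<lambda>s. \<kappa> s t) = restrict0 \<Omega> (\<lambda>s. cnj (f t) * f s)" if "t \<in> \<Omega>" for t
    using that eq by (auto simp: restrict0_def fun_eq_iff)
  have repr: "?ip h (restrict0 \<Omega> (\<lambda>s. \<kappa> s t)) = h t" if "h \<in> ?H" "t \<in> \<Omega>" for h t
  proof -
    obtain d where "h = restrict0 \<Omega> (\<lambda>s. d * f s)" using \<open>h \<in> ?H\<close> by blast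
    then show ?thesis
      using kernel[OF \<open>t \<in> \<Omega>\<close>] p \<open>t \<in> \<Omega>\<close>
      by (simp add: restrict0_def complex_norm_square del: of_real_power)
  qed
  have definite: "h = (\<lambda>s. 0)" if "h \<in> ?H" "?ip h h = 0" for h
  proof -
    obtain d where "h = restrict0 \<Omega> (\<lambda>s. d * f s)" using \<open>h \<in> ?H\<close> by blast
    moreover have "h p = 0" using \<open>?ip h h = 0\<close> p(2) by simp
    ultimately show ?thesis using p by (auto simp: restrict0_def fun_eq_iff)
  qed
  have nonneg: "Im (?ip h h) = 0 \<and> Re (?ip h h) \<ge> 0" for h
    unfolding ip_self by simp
  show ?thesis
    unfolding is_RKHS_def
  proof (intro conjI)
    show "\<forall>h\<in>?H. \<forall>s. s \<notin> \<Omega> \<longrightarrow> h s = 0" by (auto simp: restrict0_def)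
    show "\<forall>f\<in>?H. Im (?ip f f) = 0 \<and> Re (?ip f f) \<ge> 0 \<and> (?ip f f = 0 \<longrightarrow> f = (\<lambda>s. 0))"
      using nonneg definite by blast
    show "\<forall>t\<in>\<Omega>. restrict0 \<Omega> (\<lambda>s. \<kappa> s t) \<in> ?H"
    proof
      show "restrict0 \<Omega> (\<lambda>s. \<kappa> s t) \<in> ?H" if "t \<in> \<Omega>" for t
        unfolding kernel[OF that] by (rule mem)
    qed
    show "\<forall>h\<in>?H. \<forall>t\<in>\<Omega>. ?ip h (restrict0 \<Omega> (\<lambda>s. \<kappa> s t)) = h t" using repr by blast
    show "(\<lambda>s. 0) \<in> ?H" by (rule zero)
    show "\<forall>f\<in>?H. \<forall>g\<in>?H. (\<lambda>s. f s + g s) \<in> ?H" using add by blast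
    show "\<forall>c. \<forall>f\<in>?H. (\<lambda>s. c * f s) \<in> ?H" using scale by blast
    show "\<forall>f\<in>?H. \<forall>g\<in>?H. \<forall>h\<in>?H. ?ip (\<lambda>s. f s + g s) h = ?ip f h + ?ip g h"
      by (intro ballI) (simp only: distrib_right add_divide_distrib)
    show "\<forall>c. \<forall>f\<in>?H. \<forall>g\<in>?H. ?ip (\<lambda>s. c * f s) g = c * ?ip f g"
      by (intro allI ballI) (simp only: mult.assoc times_divide_eq_right)
    show "\<forall>f\<in>?H. \<forall>g\<in>?H. ?ip g f = cnj (?ip f g)"
      by (intro ballI) (simp add: mult.commute)
    show "\<forall>F::nat \<Rightarrow> complex \<Rightarrow> complex. (\<forall>k. F k \<in> ?H) \<longrightarrow>
        (\<forall>e>0. \<exists>N. \<forall>m\<ge>N. \<forall>n\<ge>N.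
            sqrt (Re (?ip (\<lambda>s. F m s - F n s) (\<lambda>s. F m s - F n s))) < e) \<longrightarrow>
        (\<exists>f\<in>?H. (\<lambda>n. sqrt (Re (?ip (\<lambda>s. F n s - f s) (\<lambda>s. F n s - f s)))) \<longlonglongrightarrow> 0)"
      by (intro allI impI) (rule complete)
  qed
qed

text \<open>Kernel sections lie in the span, so \<open>\<kappa> s t = c t * g s\<close>. Hermitian
  symmetry then makes \<open>c t\<close> a fixed multiple of \<open>cnj (g t)\<close>, and
  positivity lets a real square root of that multiple be moved into each factor.\<close>

lemma rank_one_if_is_RKHS_span:
  assumes psd: "psd_kernel \<Omega> \<kappa>"
    and R: "is_RKHS \<Omega> \<kappa> {restrict0 \<Omega> (\<lambda>s. c * g s) | c. True} ip"
    and p: "p \<in> \<Omega>" and nz: "\<forall>s\<in>\<Omega>. g s \<noteq> 0"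
  shows "\<exists>r. \<forall>s\<in>\<Omega>. \<forall>u\<in>\<Omega>. \<kappa> s u = (of_real r * g s) * cnj (of_real r * g u)"
proof -
  have "\<forall>t\<in>\<Omega>. restrict0 \<Omega> (\<lambda>s. \<kappa> s t) \<in> {restrict0 \<Omega> (\<lambda>s. c * g s) | c. True}"
    using R unfolding is_RKHS_def by (elim conjE) assumption
  then have "\<forall>t\<in>\<Omega>. \<exists>c. restrict0 \<Omega> (\<lambda>s. \<kappa> s t) = restrict0 \<Omega> (\<lambda>s. c * g s)"
    by blast
  then obtain c where "\<And>t. t \<in> \<Omega> \<Longrightarrow> restrict0 \<Omega> (\<lambda>s. \<kappa> s t) = restrict0 \<Omega> (\<lambda>s. c t * g s)"
    by metis
  then have c: "\<kappa> s t = c t * g s" if "s \<in> \<Omega>" "t \<in> \<Omega>" for s t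
    using that by (metis restrict0_def)
  \<comment> \<open>The multiple is found by comparing both sides on the diagonal at
    \<open>p\<close>, where positivity makes it nonnegative.\<close>
  define C where "C = Re (\<kappa> p p) / (norm (g p))\<^sup>2"
  have C: "C \<ge> 0" using psd_kernel_diag(2)[OF psd p] by (simp add: C_def)
  have cC: "of_real C = c p / cnj (g p)"
    unfolding C_def of_real_divide psd_kernel_diag(1)[OF psd p, symmetric] complex_norm_square
    using c[OF p p] nz p by simp
  have "c t = of_real C * cnj (g t)" if t: "t \<in> \<Omega>" for t
  proof -
    have "c t * g p = cnj (c p * g t)"
      using psd_kernel_hermitian[OF psd t p] c t p by simp
    moreover have "cnj (c p) = of_real C * g p"
      using arg_cong[OF cC, of cnj] nz p by (simp add: field_simps)
    ultimately show ?thesis using nz p by simp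
  qed
  moreover have "of_real C = of_real (sqrt C) * (of_real (sqrt C) :: complex)"
    using C by (simp flip: of_real_mult)
  ultimately have "\<forall>s\<in>\<Omega>. \<forall>u\<in>\<Omega>. \<kappa> s u = (of_real (sqrt C) * g s) * cnj (of_real (sqrt C) * g u)"
    using c by (simp add: mult_ac)
  then show ?thesis by blast
qed

subsection \<open>Leading coefficients of Dirichlet series\<close>

text \<open>For \<open>n \<ge> m\<close> the power of \<open>m / n\<close> decreases in the
  exponent, so \<open>Re s\<close> may be lowered to \<open>\<sigma> + 2\<close>:
  \<open>\<sigma>\<close> absorbs the growth of \<open>c\<close>, and 2 leaves a summable majorant
  independent of \<open>s\<close>.\<close>

lemma dirichlet_term_bound:
  fixes c s :: complex
  assumes m: "m \<ge> 1" and n: "n \<ge> 1" and C: "C \<ge> 0" and c: "norm c \<le> C * real n powr \<sigma>"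
    and zero: "n < m \<Longrightarrow> c = 0" and s: "Re s \<ge> \<sigma> + 2"
  shows "norm (of_nat m powr s * (c * of_nat n powr (- s))) \<le> C * real m powr (\<sigma> + 2) * real n powr (-2)"
proof (cases "n < m")
  case True
  then show ?thesis using zero C by simp
next
  case False
  have "norm (of_nat m powr s * (c * of_nat n powr (- s))) =
        norm c * (real m powr Re s * real n powr (- Re s))"
    using m n by (simp add: norm_mult norm_of_nat_powr)
  also have "\<dots> = norm c * (real m / real n) powr Re s"
    using m n by (simp add: powr_divide powr_minus field_simps)
  also have "\<dots> \<le> (C * real n powr \<sigma>) * (real m / real n) powr (\<sigma> + 2)"
    using False m n s by (intro mult_mono c powr_mono') (auto simp: C)
  also have "\<dots> = C * real m powr (\<sigma> + 2) * real n powr (-2)"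
    using m n by (simp add: powr_divide powr_minus powr_add field_simps)
  finally show ?thesis .
qed

lemma tendsto_powr_at_top_zero:
  assumes "0 < r" "r < (1::real)" and "filterlim f at_top F"
  shows "((\<lambda>t. r powr f t) \<longlongrightarrow> 0) F"
proof -
  have "filterlim (\<lambda>t. ln r * f t) at_bot F"
    using assms by (intro filterlim_tendsto_neg_mult_at_bot[OF tendsto_const]) auto
  then have "((\<lambda>t. exp (ln r * f t)) \<longlongrightarrow> 0) F"
    by (rule filterlim_compose[OF exp_at_bot])
  then show ?thesis using assms by (simp add: powr_def mult.commute)
qed

text \<open>Dominated convergence for series (Tannery): after multiplication by
  \<open>of_nat m powr s t\<close>, terms below \<open>m\<close> are zero, term \<open>m\<close> is
  its coefficient, and terms above \<open>m\<close> decay like powers of \<open>m / n\<close>. The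
  coefficients may vary with \<open>t\<close>, so that row sums of a double series can be
  inserted.\<close>

lemma dirichlet_leading_coefficient:
  fixes c :: "'a \<Rightarrow> nat \<Rightarrow> complex" and s :: "'a \<Rightarrow> complex"
  assumes F: "F \<noteq> bot" and m: "m \<ge> 1" and C: "C \<ge> 0"
    and bound: "\<forall>\<^sub>F t in F. \<forall>n\<ge>1. norm (c t n) \<le> C * real n powr \<sigma>"
    and zero: "\<And>t n. 1 \<le> n \<Longrightarrow> n < m \<Longrightarrow> c t n = 0"
    and lim: "((\<lambda>t. c t m) \<longlongrightarrow> l) F"
    and s: "filterlim (\<lambda>t. Re (s t)) at_top F"
  shows "((\<lambda>t. of_nat m powr s t * (\<Sum>k. c t (Suc k) * of_nat (Suc k) powr (- s t))) \<longlongrightarrow> l) F"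
proof -
  define A where "A = (\<lambda>k t. of_nat m powr s t * (c t (Suc k) * of_nat (Suc k) powr (- s t)))"
  \<comment> \<open>Index \<open>k\<close> stands for the coefficient number \<open>Suc k\<close>,
    hence \<open>m - 1\<close>.\<close>
  define b where "b = (\<lambda>k. if k = m - 1 then l else 0)"
  define M where "M = (\<lambda>k. C * real m powr (\<sigma> + 2) * real (Suc k) powr (-2))"
  have ev: "\<forall>\<^sub>F t in F. \<forall>k. norm (A k t) \<le> M k"
    using bound filterlim_at_top[THEN iffD1, OF s, rule_format, of "\<sigma> + 2"]
  proof eventually_elim
    case (elim t)
    then show ?case unfolding A_def M_def
      using m C zero by (intro allI dirichlet_term_bound) auto
  qed
  have lims: "(A k \<longlongrightarrow> b k) F" for k
  proof -
    consider "Suc k < m" | "Suc k = m" | "Suc k > m" by linarith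
    then show ?thesis
    proof cases
      case 1
      then have "b k = 0" by (auto simp: b_def)
      with 1 show ?thesis using zero by (simp add: A_def)
    next
      case 2
      then have "A k = (\<lambda>t. c t m)"
        using m by (auto simp: A_def fun_eq_iff powr_minus simp del: of_nat_Suc)
      then show ?thesis using 2 lim by (auto simp: b_def)
    next
      case 3
      have "((\<lambda>t. C * real (Suc k) powr \<sigma> * (real m / real (Suc k)) powr Re (s t)) \<longlongrightarrow> 0) F"
        using 3 m s by (intro tendsto_mult_right_zero tendsto_powr_at_top_zero) auto
      moreover have "\<forall>\<^sub>F t in F. norm (A k t) \<le> C * real (Suc k) powr \<sigma> * (real m / real (Suc k)) powr Re (s t)"
        using bound
      proof eventually_elim
        case (elim t)
        have "norm (A k t) = norm (c t (Suc k)) * (real m powr Re (s t) * real (Suc k) powr (- Re (s t)))"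
          using m by (simp add: A_def norm_mult norm_of_nat_powr del: of_nat_Suc)
        also have "\<dots> = norm (c t (Suc k)) * (real m / real (Suc k)) powr Re (s t)"
          using m by (simp add: powr_divide powr_minus field_simps del: of_nat_Suc)
        also have "\<dots> \<le> C * real (Suc k) powr \<sigma> * (real m / real (Suc k)) powr Re (s t)"
          using elim by (intro mult_right_mono) auto
        finally show ?case .
      qed
      ultimately have "(A k \<longlongrightarrow> 0) F" by (rule Lim_null_comparison[rotated])
      moreover have "b k = 0" using 3 m by (auto simp: b_def)
      ultimately show ?thesis by simp
    qed
  qed
  have "summable M" unfolding M_def by (intro summable_mult summable_Suc_powr) auto
  moreover have "\<forall>\<^sub>F (k, t) in at_top \<times>\<^sub>F F. norm (A k t) \<le> M k"
    using ev unfolding eventually_prod_filter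
    by (intro exI[of _ "\<lambda>_. True"] exI[of _ "\<lambda>t. \<forall>k. norm (A k t) \<le> M k"]) auto
  ultimately have T: "\<forall>\<^sub>F t in F. summable (\<lambda>k. norm (A k t))"
    "((\<lambda>t. \<Sum>k. A k t) \<longlongrightarrow> suminf b) F"
    using tannerys_theorem[OF lims _ _ F, where M = M] by auto
  have "b sums l" using sums_single[of "m - 1" "\<lambda>_. l"] by (simp add: b_def)
  moreover have "\<forall>\<^sub>F t in F. (\<Sum>k. A k t) =
      of_nat m powr s t * (\<Sum>k. c t (Suc k) * of_nat (Suc k) powr (- s t))"
    using T(1)
  proof eventually_elim
    case (elim t)
    have "summable (\<lambda>k. of_nat m powr (- s t) * A k t)"
      by (intro summable_mult summable_norm_cancel[OF elim])
    then have "summable (\<lambda>k. c t (Suc k) * of_nat (Suc k) powr (- s t))"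
      using m by (simp add: A_def powr_minus field_simps)
    then show ?case unfolding A_def by (rule suminf_mult)
  qed
  ultimately show ?thesis
    using T(2) by (auto simp: sums_iff intro: Lim_transform_eventually)
qed

text \<open>By strong induction \<open>c n\<close> is the leading coefficient of what remains, hence
  the limit of a function that is eventually zero.\<close>

lemma dirichlet_coefficients_zero:
  fixes c :: "nat \<Rightarrow> complex"
  assumes C: "C \<ge> 0" and bound: "\<And>n. n \<ge> 1 \<Longrightarrow> norm (c n) \<le> C * real n powr \<sigma>"
    and zero: "\<forall>\<^sub>F x in at_top. (\<Sum>k. c (Suc k) * of_nat (Suc k) powr (- complex_of_real x)) = 0"
    and n: "n \<ge> 1"
  shows "c n = 0"
  using n
proof (induction n rule: less_induct)
  case (less n)
  have "((\<lambda>x. of_nat n powr complex_of_real x *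
      (\<Sum>k. c (Suc k) * of_nat (Suc k) powr (- complex_of_real x))) \<longlongrightarrow> c n) at_top"
    by (rule dirichlet_leading_coefficient[where C = C and \<sigma> = \<sigma>])
      (use less C bound in \<open>auto simp: filterlim_ident\<close>)
  moreover have "\<forall>\<^sub>F x in at_top. of_nat n powr complex_of_real x *
      (\<Sum>k. c (Suc k) * of_nat (Suc k) powr (- complex_of_real x)) = 0"
    using zero by eventually_elim simp
  ultimately have "((\<lambda>x::real. 0) \<longlongrightarrow> c n) at_top"
    by (rule Lim_transform_eventually)
  then show ?case by (simp add: tendsto_const_iff)
qed

subsection \<open>Regularly convergent double series\<close>

lemma double_sums_double_sum:
  assumes "double_sums c L"
  shows "double_sum c = L"
  unfolding double_sum_def
  using assms by (intro tendsto_Lim) (auto simp: double_sums_def prod_filter_eq_bot)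

text \<open>Joint convergence is symmetric in the two indices; this turns statements on rows into
  statements on columns.\<close>

lemma double_sums_transpose:
  "double_sums (\<lambda>m n. c n m) L \<longleftrightarrow> double_sums c L"
proof -
  have "double_sums (\<lambda>m n. c n m) L" if "double_sums c L" for c L
  proof -
    have "((\<lambda>(M, N). \<Sum>m\<in>{1..M}. \<Sum>n\<in>{1..N}. c m n) \<longlongrightarrow> L)
        (filtermap prod.swap (sequentially \<times>\<^sub>F sequentially))"
      using that unfolding double_sums_def by (subst (asm) prod_filter_commute) (simp add: prod.swap_def)
    then show ?thesis unfolding double_sums_def
      by (simp add: filterlim_filtermap case_prod_unfold sum.swap[of "\<lambda>m n. c m n"])
  qed
  from this[of c L] this[of "\<lambda>m n. c n m" L] show ?thesis by blast
qed

lemma dd_term_transpose: "dd_term (\<lambda>m n. c n m) u s = (\<lambda>m n. dd_term c s u n m)"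
  by (auto simp: dd_term_def fun_eq_iff)

lemma regularly_convergent_at_transpose:
  "regularly_convergent_at c s u \<Longrightarrow> regularly_convergent_at (\<lambda>m n. c n m) u s"
  unfolding regularly_convergent_at_def dd_term_transpose[of c u s]
    double_sums_transpose[of "dd_term c s u"] by blast

lemma double_sum_transpose:
  assumes "regularly_convergent_at c s u"
  shows "double_sum (dd_term (\<lambda>m n. c n m) u s) = double_sum (dd_term c s u)"
proof -
  obtain L where L: "double_sums (dd_term c s u) L"
    using assms by (auto simp: regularly_convergent_at_def)
  then have "double_sums (\<lambda>m n. dd_term c s u n m) L"
    by (rule double_sums_transpose[THEN iffD2])
  with L show ?thesis
    unfolding dd_term_transpose[of c u s] by (simp only: double_sums_double_sum)
qed

text \<open>Convergent rows allow the limit in \<open>N\<close> at fixed \<open>M\<close>, and joint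
  convergence keeps that limit close to the double sum for all large \<open>M\<close>. The double
  series thus becomes a Dirichlet series in \<open>s\<close> whose coefficients are row sums,
  without absolute convergence.\<close>

lemma regularly_convergent_at_iterated:
  assumes "regularly_convergent_at c s u"
  shows "(\<lambda>k. (\<Sum>j. c (Suc k) (Suc j) * of_nat (Suc j) powr (- u)) * of_nat (Suc k) powr (- s))
           sums double_sum (dd_term c s u)"
proof -
  define L where "L = double_sum (dd_term c s u)"
  have "double_sums (dd_term c s u) L"
    using assms double_sums_double_sum unfolding regularly_convergent_at_def L_def by blast
  then have lim: "((\<lambda>(M, N). \<Sum>m\<in>{1..M}. \<Sum>n\<in>{1..N}. dd_term c s u m n) \<longlongrightarrow> L)
      (sequentially \<times>\<^sub>F sequentially)" (is "((\<lambda>(M, N). ?S M N) \<longlongrightarrow> L) _")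
    by (simp add: double_sums_def)
  define R where "R = (\<lambda>M. \<Sum>k<M. (\<Sum>j. c (Suc k) (Suc j) * of_nat (Suc j) powr (- u)) * of_nat (Suc k) powr (- s))"
  have row: "(\<lambda>N. ?S M N) \<longlonglongrightarrow> R M" for M
  proof -
    have "(\<lambda>N. \<Sum>k<M. (\<Sum>j<N. c (Suc k) (Suc j) * of_nat (Suc j) powr (- u)) * of_nat (Suc k) powr (- s)) \<longlonglongrightarrow> R M"
      unfolding R_def using assms
      by (intro tendsto_sum tendsto_mult tendsto_const summable_LIMSEQ)
         (auto simp: regularly_convergent_at_def)
    moreover have "?S M N = (\<Sum>k<M. (\<Sum>j<N. c (Suc k) (Suc j) * of_nat (Suc j) powr (- u)) * of_nat (Suc k) powr (- s))" for N
      by (simp add: sum.atLeast1_atMost_eq dd_term_def sum_distrib_left sum_distrib_right mult_ac)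
    ultimately show ?thesis by simp
  qed
  have "R \<longlonglongrightarrow> L"
  proof (rule LIMSEQ_I)
    fix e :: real assume e: "e > 0"
    have "\<forall>\<^sub>F (M, N) in sequentially \<times>\<^sub>F sequentially. norm (?S M N - L) < e / 2"
      using tendstoD[OF lim, of "e / 2"] e by (simp add: dist_norm case_prod_unfold)
    then obtain K where K: "\<And>M N. M \<ge> K \<Longrightarrow> N \<ge> K \<Longrightarrow> norm (?S M N - L) < e / 2"
      unfolding eventually_prod_sequentially by auto
    have "norm (R M - L) < e" if "M \<ge> K" for M
    proof -
      have "(\<lambda>N. norm (?S M N - L)) \<longlonglongrightarrow> norm (R M - L)"
        by (intro tendsto_norm tendsto_diff row tendsto_const)
      then have "norm (R M - L) \<le> e / 2"
        by (rule LIMSEQ_le_const2) (use K that less_imp_le in blast)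
      then show ?thesis using e by simp
    qed
    then show "\<exists>K. \<forall>M\<ge>K. norm (R M - L) < e" by blast
  qed
  then show ?thesis unfolding sums_def R_def L_def .
qed

section \<open>Growth of the coefficients\<close>

lemma regularly_convergent_at_row_bound:
  assumes "regularly_convergent_at c s u" and m: "m \<ge> 1"
  shows "\<exists>B\<ge>0. \<forall>n\<ge>1. norm (dd_term c s u m n) \<le> B"
proof -
  have "summable (\<lambda>k. c m (Suc k) * of_nat (Suc k) powr (- u))"
    using assms by (auto simp: regularly_convergent_at_def)
  then have "Bseq (\<lambda>k. c m (Suc k) * of_nat (Suc k) powr (- u))"
    by (intro convergent_imp_Bseq) (auto simp: convergent_def dest: summable_LIMSEQ_zero)
  then obtain B where B: "B > 0" "\<And>k. norm (c m (Suc k) * of_nat (Suc k) powr (- u)) \<le> B"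
    unfolding Bseq_def by blast
  have "norm (dd_term c s u m n) \<le> B * norm ((of_nat m :: complex) powr (- s))" if "n \<ge> 1" for n
  proof -
    have "dd_term c s u m n = (c m n * of_nat n powr (- u)) * of_nat m powr (- s)"
      by (simp add: dd_term_def mult_ac)
    then show ?thesis using B(2)[of "n - 1"] that
      by (simp add: norm_mult mult_right_mono)
  qed
  then show ?thesis using B(1)
    by (intro exI[of _ "B * norm ((of_nat m :: complex) powr (- s))"]) auto
qed

text \<open>A single term is recovered as a mixed second difference of rectangular sums.\<close>

lemma rectangle_difference:
  fixes c :: "nat \<Rightarrow> nat \<Rightarrow> 'a :: ab_group_add"
  shows "((\<Sum>i\<in>{1..Suc m}. \<Sum>j\<in>{1..Suc n}. c i j) - (\<Sum>i\<in>{1..m}. \<Sum>j\<in>{1..Suc n}. c i j)) -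
    ((\<Sum>i\<in>{1..Suc m}. \<Sum>j\<in>{1..n}. c i j) - (\<Sum>i\<in>{1..m}. \<Sum>j\<in>{1..n}. c i j)) = c (Suc m) (Suc n)"
proof -
  have "(\<Sum>i\<in>{1..Suc m}. f i) - (\<Sum>i\<in>{1..m}. f i) = f (Suc m)" for f :: "nat \<Rightarrow> 'a" and m
    by simp
  then show ?thesis by (simp only:)
qed

text \<open>Convergence of rectangular sums controls only terms with both indices beyond some
  \<open>K\<close>: such a term combines four sums within 1 of the limit. The rest lies in finitely
  many rows and columns, each bounded because it converges as a single series.\<close>

lemma regularly_convergent_at_term_bound:
  assumes rc: "regularly_convergent_at c s u"
  shows "\<exists>B\<ge>0. \<forall>m\<ge>1. \<forall>n\<ge>1. norm (dd_term c s u m n) \<le> B"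
proof -
  obtain L where "double_sums (dd_term c s u) L"
    using rc unfolding regularly_convergent_at_def by blast
  define S where "S = (\<lambda>M N. \<Sum>m\<in>{1..M}. \<Sum>n\<in>{1..N}. dd_term c s u m n)"
  have "((\<lambda>(M, N). S M N) \<longlongrightarrow> L) (sequentially \<times>\<^sub>F sequentially)"
    using \<open>double_sums (dd_term c s u) L\<close> by (simp add: double_sums_def S_def)
  from tendstoD[OF this, of 1]
  have "\<forall>\<^sub>F (M, N) in sequentially \<times>\<^sub>F sequentially. norm (S M N - L) < 1"
    by (simp add: dist_norm case_prod_unfold)
  then obtain K where K: "\<And>M N. M \<ge> K \<Longrightarrow> N \<ge> K \<Longrightarrow> norm (S M N - L) < 1"
    unfolding eventually_prod_sequentially by auto
  have far: "norm (dd_term c s u m n) \<le> 4" if "m > K" "n > K" for m n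
  proof -
    define m' n' where "m' = m - 1" and "n' = n - 1"
    have mn: "m = Suc m'" "n = Suc n'" "m' \<ge> K" "n' \<ge> K"
      using that by (auto simp: m'_def n'_def)
    have "dd_term c s u m n = ((S m n - L) - (S m' n - L)) - ((S m n' - L) - (S m' n' - L))"
      unfolding mn(1,2) S_def rectangle_difference[symmetric] by simp
    also have "norm \<dots> \<le> (norm (S m n - L) + norm (S m' n - L)) + (norm (S m n' - L) + norm (S m' n' - L))"
      by (rule order_trans[OF norm_triangle_ineq4 add_mono[OF norm_triangle_ineq4 norm_triangle_ineq4]])
    also have "\<dots> \<le> 4"
      using K[of m n] K[of m' n] K[of m n'] K[of m' n'] mn(3,4) that by linarith
    finally show ?thesis .
  qed
  have "\<forall>m\<in>{1..}. \<exists>B\<ge>0. \<forall>n\<ge>1. norm (dd_term c s u m n) \<le> B"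
    using regularly_convergent_at_row_bound[OF rc] by auto
  then obtain B where B: "\<And>m. m \<ge> 1 \<Longrightarrow> B m \<ge> 0"
    "\<And>m n. m \<ge> 1 \<Longrightarrow> n \<ge> 1 \<Longrightarrow> norm (dd_term c s u m n) \<le> B m"
    by (metis atLeast_iff)
  have "\<forall>n\<in>{1..}. \<exists>B\<ge>0. \<forall>m\<ge>1. norm (dd_term c s u m n) \<le> B"
    using regularly_convergent_at_row_bound[OF regularly_convergent_at_transpose[OF rc]]
    unfolding dd_term_transpose[of c u s] by auto
  then obtain B' where B': "\<And>n. n \<ge> 1 \<Longrightarrow> B' n \<ge> 0"
    "\<And>m n. m \<ge> 1 \<Longrightarrow> n \<ge> 1 \<Longrightarrow> norm (dd_term c s u m n) \<le> B' n"
    by (metis atLeast_iff)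
  \<comment> \<open>A sum of nonnegative bounds stands in for their maximum.\<close>
  define T where "T = 4 + (\<Sum>m=1..K. B m) + (\<Sum>n=1..K. B' n)"
  have nn: "(\<Sum>m=1..K. B m) \<ge> 0" "(\<Sum>n=1..K. B' n) \<ge> 0"
    using B(1) B'(1) by (auto intro!: sum_nonneg)
  have "norm (dd_term c s u m n) \<le> T" if mn: "m \<ge> 1" "n \<ge> 1" for m n
  proof -
    consider "m > K" "n > K" | "m \<le> K" | "n \<le> K" by linarith
    then show ?thesis
    proof cases
      case 1
      then show ?thesis using far[of m n] nn by (simp add: T_def)
    next
      case 2
      have "B m \<le> (\<Sum>m=1..K. B m)" using 2 mn B(1) by (intro member_le_sum) auto
      then show ?thesis using B(2)[OF mn] nn by (simp add: T_def)
    next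
      case 3
      have "B' n \<le> (\<Sum>n=1..K. B' n)" using 3 mn B'(1) by (intro member_le_sum) auto
      then show ?thesis using B'(2)[OF mn] nn by (simp add: T_def)
    qed
  qed
  then show ?thesis using nn by (intro exI[of _ T]) (auto simp: T_def)
qed

text \<open>Bounded terms at the single point with both coordinates \<open>\<rho> + 1\<close>
  already give polynomial growth in each index.\<close>

lemma is_ds_kernel_on_coefficient_bound:
  assumes "is_ds_kernel_on \<rho> c"
  shows "\<exists>C\<ge>0. \<forall>m\<ge>1. \<forall>n\<ge>1. norm (c m n) \<le> C * real m powr (\<rho> + 1) * real n powr (\<rho> + 1)"
proof -
  define z where "z = complex_of_real (\<rho> + 1)"
  have "regularly_convergent_at c z z"
    using assms by (auto simp: is_ds_kernel_on_def halfplane_def z_def)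
  then obtain C where C: "C \<ge> 0" "\<And>m n. m \<ge> 1 \<Longrightarrow> n \<ge> 1 \<Longrightarrow> norm (dd_term c z z m n) \<le> C"
    using regularly_convergent_at_term_bound by blast
  have "norm (c m n) \<le> C * real m powr (\<rho> + 1) * real n powr (\<rho> + 1)" if mn: "m \<ge> 1" "n \<ge> 1" for m n
  proof -
    have z: "Re (- z) = - (\<rho> + 1)" by (simp add: z_def)
    have "norm (dd_term c z z m n) = norm (c m n) / (real m powr (\<rho> + 1) * real n powr (\<rho> + 1))"
      unfolding dd_term_def norm_mult norm_of_nat_powr[OF mn(1)] norm_of_nat_powr[OF mn(2)] z
      by (simp only: powr_minus divide_inverse inverse_mult_distrib mult.assoc)
    then have "norm (c m n) / (real m powr (\<rho> + 1) * real n powr (\<rho> + 1)) \<le> C"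
      using C(2)[OF mn] by simp
    moreover have "real m powr (\<rho> + 1) * real n powr (\<rho> + 1) > 0" using mn by simp
    ultimately show ?thesis by (simp only: pos_divide_le_eq mult.assoc)
  qed
  with C(1) show ?thesis by blast
qed

text \<open>The bound is uniform in \<open>u\<close> and proportional to \<open>C\<close>; applied
  to a row, \<open>C\<close> carries the growth in the row index, so row sums again satisfy a
  polynomial bound.\<close>

lemma scaled_row_sum_bound:
  fixes c :: "nat \<Rightarrow> complex"
  assumes m: "m \<ge> 1" and C: "C \<ge> 0" and bound: "\<And>n. n \<ge> 1 \<Longrightarrow> norm (c n) \<le> C * real n powr \<sigma>"
    and zero: "\<And>n. 1 \<le> n \<Longrightarrow> n < m \<Longrightarrow> c n = 0" and u: "Re u \<ge> \<sigma> + 2"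
  shows "norm (of_nat m powr u * (\<Sum>j. c (Suc j) * of_nat (Suc j) powr (- u)))
           \<le> C * (real m powr (\<sigma> + 2) * (\<Sum>j. real (Suc j) powr (-2)))"
proof -
  have Z: "summable (\<lambda>j. real (Suc j) powr (-2))" by (rule summable_Suc_powr) simp
  let ?t = "\<lambda>j. of_nat m powr u * (c (Suc j) * of_nat (Suc j) powr (- u))"
  have le: "norm (?t j) \<le> C * real m powr (\<sigma> + 2) * real (Suc j) powr (-2)" for j
    by (rule dirichlet_term_bound) (use assms bound[of "Suc j"] zero[of "Suc j"] in auto)
  have M: "summable (\<lambda>j. C * real m powr (\<sigma> + 2) * real (Suc j) powr (-2))"
    by (intro summable_mult Z)
  have S: "summable (\<lambda>j. norm (?t j))"
    by (rule summable_comparison_test'[OF M, of 0]) (use le in auto)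
  have "summable (\<lambda>k. of_nat m powr (- u) * ?t k)"
    by (intro summable_mult summable_norm_cancel[OF S])
  then have "summable (\<lambda>k. c (Suc k) * of_nat (Suc k) powr (- u))"
    using m by (simp add: powr_minus field_simps)
  then have "of_nat m powr u * (\<Sum>j. c (Suc j) * of_nat (Suc j) powr (- u)) = (\<Sum>j. ?t j)"
    by (rule suminf_mult[symmetric])
  also have "norm \<dots> \<le> (\<Sum>j. norm (?t j))" by (rule summable_norm[OF S])
  also have "\<dots> \<le> (\<Sum>j. C * real m powr (\<sigma> + 2) * real (Suc j) powr (-2))"
    by (rule suminf_le[OF le S M])
  also have "\<dots> = C * (real m powr (\<sigma> + 2) * (\<Sum>j. real (Suc j) powr (-2)))"
    unfolding mult.assoc[symmetric] by (rule suminf_mult[OF Z])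
  finally show ?thesis .
qed

text \<open>The one-variable lemma is used twice: inside, to show that the scaled sum of row
  \<open>m0\<close> tends to the corner coefficient; outside, with the scaled row sums
  \<open>d t m\<close> as coefficients depending on \<open>t\<close>.\<close>

lemma double_dirichlet_leading_coefficient:
  fixes s u :: "'a \<Rightarrow> complex"
  assumes ds: "is_ds_kernel_on \<rho> c" and F: "F \<noteq> bot" and m0: "m0 \<ge> 1"
    and zero: "\<And>m n. 1 \<le> m \<Longrightarrow> 1 \<le> n \<Longrightarrow> m < m0 \<or> n < m0 \<Longrightarrow> c m n = 0"
    and s: "filterlim (\<lambda>t. Re (s t)) at_top F" and u: "filterlim (\<lambda>t. Re (u t)) at_top F"
  shows "((\<lambda>t. of_nat m0 powr s t * of_nat m0 powr u t * double_sum (dd_term c (s t) (u t)))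
           \<longlongrightarrow> c m0 m0) F"
proof -
  define \<sigma> where "\<sigma> = \<rho> + 1"
  obtain C where C: "C \<ge> 0"
    "\<And>m n. m \<ge> 1 \<Longrightarrow> n \<ge> 1 \<Longrightarrow> norm (c m n) \<le> C * real m powr \<sigma> * real n powr \<sigma>"
    using is_ds_kernel_on_coefficient_bound[OF ds] unfolding \<sigma>_def by blast
  define d where "d = (\<lambda>t m. of_nat m0 powr u t * (\<Sum>j. c m (Suc j) * of_nat (Suc j) powr (- u t)))"
  define Z where "Z = real m0 powr (\<sigma> + 2) * (\<Sum>j. real (Suc j) powr (-2))"
  have Z: "Z \<ge> 0" unfolding Z_def by (intro mult_nonneg_nonneg suminf_nonneg summable_Suc_powr) auto
  have "((\<lambda>t. of_nat m0 powr s t * (\<Sum>k. d t (Suc k) * of_nat (Suc k) powr (- s t))) \<longlongrightarrow> c m0 m0) F"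
  proof (rule dirichlet_leading_coefficient[where C = "C * Z" and \<sigma> = \<sigma>])
    show "\<forall>\<^sub>F t in F. \<forall>n\<ge>1. norm (d t n) \<le> C * Z * real n powr \<sigma>"
      using filterlim_at_top[THEN iffD1, OF u, rule_format, of "\<sigma> + 2"]
    proof eventually_elim
      case (elim t)
      show ?case
      proof (intro allI impI)
        fix n :: nat assume n: "n \<ge> 1"
        have "norm (d t n) \<le> (C * real n powr \<sigma>) * Z" unfolding d_def Z_def
          using m0 C n zero elim by (intro scaled_row_sum_bound) auto
        then show "norm (d t n) \<le> C * Z * real n powr \<sigma>" by (simp add: mult_ac)
      qed
    qed
    show "d t n = 0" if "1 \<le> n" "n < m0" for t n using that zero by (simp add: d_def)
    show "((\<lambda>t. d t m0) \<longlongrightarrow> c m0 m0) F" unfolding d_def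
      using m0 C zero by (intro dirichlet_leading_coefficient[where C = "C * real m0 powr \<sigma>" and \<sigma> = \<sigma>] F u) auto
  qed (use F m0 C Z s in auto)
  moreover have "\<forall>\<^sub>F t in F. of_nat m0 powr s t * (\<Sum>k. d t (Suc k) * of_nat (Suc k) powr (- s t)) =
     of_nat m0 powr s t * of_nat m0 powr u t * double_sum (dd_term c (s t) (u t))"
    using filterlim_at_top[THEN iffD1, OF u, rule_format, of "\<sigma>"]
          filterlim_at_top[THEN iffD1, OF s, rule_format, of "\<sigma>"]
  proof eventually_elim
    case (elim t)
    then have "regularly_convergent_at c (s t) (u t)"
      using ds by (auto simp: is_ds_kernel_on_def halfplane_def \<sigma>_def)
    note it = regularly_convergent_at_iterated[OF this]
    from sums_mult[OF it, of "of_nat m0 powr u t"]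
    have "(\<lambda>k. d t (Suc k) * of_nat (Suc k) powr (- s t)) sums
        (of_nat m0 powr u t * double_sum (dd_term c (s t) (u t)))"
      by (simp add: d_def mult.assoc)
    then show ?case by (simp add: sums_iff mult.assoc)
  qed
  ultimately show ?thesis by (rule Lim_transform_eventually)
qed

text \<open>If the corner coefficient vanished, the Cauchy--Schwarz bound would force the leading term
  in \<open>s\<close> of the kernel, which is the Dirichlet series of row \<open>m0\<close>, to vanish.\<close>

lemma corner_zero_imp_row_zero:
  assumes ds: "is_ds_kernel_on \<rho> c" and m0: "m0 \<ge> 1"
    and CS: "\<And>s u. s \<in> halfplane \<rho> \<Longrightarrow> u \<in> halfplane \<rho> \<Longrightarrow> (norm (double_sum (dd_term c s u)))\<^sup>2
       \<le> norm (double_sum (dd_term c s (cnj s))) * norm (double_sum (dd_term c (cnj u) u))"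
    and zero: "\<And>m n. 1 \<le> m \<Longrightarrow> 1 \<le> n \<Longrightarrow> m < m0 \<or> n < m0 \<Longrightarrow> c m n = 0"
    and corner: "c m0 m0 = 0" and n: "n \<ge> 1"
  shows "c m0 n = 0"
proof -
  define \<sigma> where "\<sigma> = \<rho> + 1"
  obtain C where C: "C \<ge> 0"
    "\<And>m n. m \<ge> 1 \<Longrightarrow> n \<ge> 1 \<Longrightarrow> norm (c m n) \<le> C * real m powr \<sigma> * real n powr \<sigma>"
    using is_ds_kernel_on_coefficient_bound[OF ds] unfolding \<sigma>_def by blast
  have row: "(\<Sum>j. c m0 (Suc j) * of_nat (Suc j) powr (- u)) = 0"
    if u: "u \<in> halfplane \<rho>" "Re u \<ge> \<sigma> + 2" for u
  proof -
    define d where "d = (\<lambda>m. \<Sum>j. c m (Suc j) * of_nat (Suc j) powr (- u))"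
    \<comment> \<open>Here \<open>u\<close> stays fixed and no rescaling is wanted, so the row bound
      is used with leading index 1.\<close>
    define Z where "Z = real 1 powr (\<sigma> + 2) * (\<Sum>j. real (Suc j) powr (-2))"
    have Z: "Z \<ge> 0" unfolding Z_def by (intro mult_nonneg_nonneg suminf_nonneg summable_Suc_powr) auto
    have dbound: "norm (d m) \<le> C * Z * real m powr \<sigma>" if m: "m \<ge> 1" for m
    proof -
      have "norm (of_nat 1 powr u * d m) \<le> (C * real m powr \<sigma>) * Z" unfolding d_def Z_def
        using C m u by (intro scaled_row_sum_bound) auto
      then show ?thesis by (simp add: mult_ac)
    qed
    define D where "D = (\<lambda>x::real. double_sum (dd_term c (of_real x) u))"
    have "((\<lambda>x::real. of_nat m0 powr of_real x * (\<Sum>k. d (Suc k) * of_nat (Suc k) powr (- of_real x))) \<longlongrightarrow> d m0) at_top"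
      by (rule dirichlet_leading_coefficient[where C = "C * Z" and \<sigma> = \<sigma>])
        (use m0 C Z dbound zero in \<open>auto simp: filterlim_ident d_def\<close>)
    moreover have "\<forall>\<^sub>F x in at_top. of_nat m0 powr of_real x *
        (\<Sum>k. d (Suc k) * of_nat (Suc k) powr (- of_real x)) = of_nat m0 powr of_real x * D x"
      using eventually_gt_at_top[of \<rho>]
    proof eventually_elim
      case (elim x)
      then have "regularly_convergent_at c (of_real x) u"
        using ds u by (auto simp: is_ds_kernel_on_def halfplane_def)
      from regularly_convergent_at_iterated[OF this] show ?case
        by (simp add: sums_iff d_def D_def)
    qed
    ultimately have lim: "((\<lambda>x::real. of_nat m0 powr of_real x * D x) \<longlongrightarrow> d m0) at_top"
      by (rule Lim_transform_eventually)
    \<comment> \<open>The rescaled diagonal values tend to the corner, which is zero. By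
      Cauchy-Schwarz they dominate the square of the rescaled \<open>D\<close>, whose limit is the
      row sum \<open>d m0\<close>.\<close>
    define Q where "Q = (\<lambda>x::real. of_nat m0 powr of_real x * of_nat m0 powr of_real x *
        double_sum (dd_term c (of_real x) (of_real x)))"
    have "(Q \<longlongrightarrow> c m0 m0) at_top" unfolding Q_def
      by (rule double_dirichlet_leading_coefficient[OF ds])
        (use m0 zero in \<open>auto simp: filterlim_ident\<close>)
    then have "((\<lambda>x. norm (Q x)) \<longlongrightarrow> 0) at_top" unfolding corner by (rule tendsto_norm_zero)
    then have Q0: "((\<lambda>x. norm (Q x) * norm (double_sum (dd_term c (cnj u) u))) \<longlongrightarrow> 0) at_top"
      by (rule tendsto_mult_left_zero)
    have "((\<lambda>x. (norm (of_nat m0 powr of_real x * D x))\<^sup>2) \<longlongrightarrow> 0) at_top"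
    proof (rule Lim_null_comparison[OF _ Q0])
      show "\<forall>\<^sub>F x in at_top. norm ((norm (of_nat m0 powr of_real x * D x))\<^sup>2)
          \<le> norm (Q x) * norm (double_sum (dd_term c (cnj u) u))"
        using eventually_gt_at_top[of \<rho>]
      proof eventually_elim
        case (elim x)
        have "(norm (D x))\<^sup>2 \<le> norm (double_sum (dd_term c (of_real x) (of_real x))) *
            norm (double_sum (dd_term c (cnj u) u))"
          using CS[of "of_real x" u] elim u by (simp add: halfplane_def D_def)
        then have "(norm ((of_nat m0 :: complex) powr of_real x))\<^sup>2 * (norm (D x))\<^sup>2 \<le>
            (norm ((of_nat m0 :: complex) powr of_real x))\<^sup>2 *
            (norm (double_sum (dd_term c (of_real x) (of_real x))) *
            norm (double_sum (dd_term c (cnj u) u)))"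
          by (rule mult_left_mono) simp
        then show ?case
          by (simp add: Q_def norm_mult power_mult_distrib power2_eq_square mult_ac)
      qed
    qed
    moreover have "((\<lambda>x. (norm (of_nat m0 powr of_real x * D x))\<^sup>2) \<longlongrightarrow> (norm (d m0))\<^sup>2) at_top"
      by (intro tendsto_power tendsto_norm lim)
    ultimately have "(norm (d m0))\<^sup>2 = 0"
      using tendsto_unique trivial_limit_at_top_linorder by blast
    then show ?thesis by (simp add: d_def)
  qed
  show ?thesis
  proof (rule dirichlet_coefficients_zero[OF _ _ _ n])
    show "norm (c m0 n) \<le> C * real m0 powr \<sigma> * real n powr \<sigma>" if "n \<ge> 1" for n
      using C(2) m0 that by blast
    show "\<forall>\<^sub>F x in at_top. (\<Sum>k. c m0 (Suc k) * of_nat (Suc k) powr (- complex_of_real x)) = 0"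
      using eventually_ge_at_top[of "\<sigma> + 2"]
      by eventually_elim (rule row, auto simp: halfplane_def \<sigma>_def)
  qed (use C in auto)
qed

subsection \<open>Dilation invariance forces rank one\<close>

lemma cnj_halfplane: "s \<in> halfplane \<rho> \<Longrightarrow> cnj s \<in> halfplane \<rho>"
  by (simp add: halfplane_def)

text \<open>If the corner vanished, so would all of row \<open>m0\<close>, and by transposition all
  of column \<open>m0\<close>, contrary to the choice of \<open>m0\<close>.\<close>

lemma ds_kernel_corner:
  assumes ds: "is_ds_kernel_on \<rho> a" and psd: "psd_kernel (halfplane \<rho>) (ds_kernel a)"
    and nz: "\<exists>m\<ge>1. \<exists>n\<ge>1. a m n \<noteq> 0"
  obtains m0 where "m0 \<ge> 1" "a m0 m0 \<noteq> 0"
    "\<And>m n. 1 \<le> m \<Longrightarrow> 1 \<le> n \<Longrightarrow> m < m0 \<or> n < m0 \<Longrightarrow> a m n = 0"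
proof -
  define P where "P = (\<lambda>m::nat. m \<ge> 1 \<and> (\<exists>n\<ge>1. a m n \<noteq> 0 \<or> a n m \<noteq> 0))"
  define m0 where "m0 = (LEAST m. P m)"
  have "\<exists>m. P m" using nz unfolding P_def by blast
  then have P0: "P m0" unfolding m0_def by (rule LeastI_ex)
  have least: "\<not> P m" if "m < m0" for m using not_less_Least that unfolding m0_def by blast
  have m0: "m0 \<ge> 1" using P0 unfolding P_def by blast
  have zero: "a m n = 0" if "1 \<le> m" "1 \<le> n" "m < m0 \<or> n < m0" for m n
    using that least[of m] least[of n] unfolding P_def by blast
  have rc: "regularly_convergent_at a s u" if "s \<in> halfplane \<rho>" "u \<in> halfplane \<rho>" for s u
    using ds that by (simp add: is_ds_kernel_on_def)
  \<comment> \<open>\<open>ds_kernel\<close> conjugates its second argument, so the double series at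
    \<open>(s, u)\<close> is the kernel at \<open>(s, cnj u)\<close>.\<close>
  have CS: "(norm (double_sum (dd_term a s u)))\<^sup>2
       \<le> norm (double_sum (dd_term a s (cnj s))) * norm (double_sum (dd_term a (cnj u) u))"
    if "s \<in> halfplane \<rho>" "u \<in> halfplane \<rho>" for s u
    using psd_kernel_Cauchy_Schwarz[OF psd that(1) cnj_halfplane[OF that(2)]]
    by (simp add: ds_kernel_def)
  have "a m0 m0 \<noteq> 0"
  proof
    assume corner: "a m0 m0 = 0"
    have rows: "a m0 n = 0" if "n \<ge> 1" for n
      by (rule corner_zero_imp_row_zero[OF ds m0 CS zero corner that])
    \<comment> \<open>The transposed matrix inherits regular convergence, and the Cauchy-Schwarz
      bound is symmetric under exchange of the two variables.\<close>
    define b where "b = (\<lambda>m n. a n m)"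
    have "is_ds_kernel_on \<rho> b"
      unfolding is_ds_kernel_on_def b_def using rc regularly_convergent_at_transpose by blast
    moreover have "(norm (double_sum (dd_term b s u)))\<^sup>2
       \<le> norm (double_sum (dd_term b s (cnj s))) * norm (double_sum (dd_term b (cnj u) u))"
      if "s \<in> halfplane \<rho>" "u \<in> halfplane \<rho>" for s u
    proof -
      have b: "double_sum (dd_term b s u) = double_sum (dd_term a u s)"
        if "s \<in> halfplane \<rho>" "u \<in> halfplane \<rho>" for s u
        unfolding b_def by (rule double_sum_transpose[OF rc[OF that(2,1)]])
      show ?thesis
        unfolding b[OF that] b[OF that(1) cnj_halfplane[OF that(1)]] b[OF cnj_halfplane[OF that(2)] that(2)]
        using CS[OF that(2,1)] by (simp add: mult.commute)
    qed
    moreover have "b m n = 0" if "1 \<le> m" "1 \<le> n" "m < m0 \<or> n < m0" for m n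
      using zero that unfolding b_def by blast
    moreover have "b m0 m0 = 0" using corner by (simp add: b_def)
    ultimately have "b m0 n = 0" if "n \<ge> 1" for n
      using corner_zero_imp_row_zero[of \<rho> b m0 n] m0 that by blast
    with rows P0 show False unfolding P_def b_def by blast
  qed
  with m0 zero show thesis using that by blast
qed

lemma ds_kernel_zero:
  assumes "\<And>m n. m \<ge> 1 \<Longrightarrow> n \<ge> 1 \<Longrightarrow> a m n = 0"
  shows "ds_kernel a s u = 0"
  unfolding ds_kernel_def
proof (rule double_sums_double_sum)
  have "(\<Sum>m\<in>{1..M}. \<Sum>n\<in>{1..N}. dd_term a s (cnj u) m n) = 0" for M N
    using assms by (auto simp: dd_term_def intro!: sum.neutral)
  then show "double_sums (dd_term a s (cnj u)) 0"
    by (simp add: double_sums_def case_prod_unfold)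
qed

lemma dilation_filterlim:
  assumes "s \<in> halfplane \<rho>"
  shows "filterlim (\<lambda>t::real. Re (of_real \<rho> + of_real t * (s - of_real \<rho>))) at_top at_top"
proof -
  have "filterlim (\<lambda>t::real. (Re s - \<rho>) * t) at_top at_top"
    using assms by (intro filterlim_tendsto_pos_mult_at_top[OF tendsto_const] filterlim_ident)
      (simp add: halfplane_def)
  then have "filterlim (\<lambda>t::real. \<rho> + (Re s - \<rho>) * t) at_top at_top"
    by (rule filterlim_tendsto_add_at_top[OF tendsto_const])
  then show ?thesis by (simp add: mult.commute)
qed

lemma rank_one_if_quasi_invariant_Aut_L_H:
  assumes ds: "is_ds_kernel_on \<rho> a"
    and qi: "quasi_invariant (Aut_L_H \<rho>) (halfplane \<rho>) J (ds_kernel a)"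
  shows "\<exists>f. is_dirichlet_series_on \<rho> f \<and>
          (\<forall>s\<in>halfplane \<rho>. \<forall>u\<in>halfplane \<rho>. ds_kernel a s u = f s * cnj (f u)) \<and>
          ((\<forall>s\<in>halfplane \<rho>. f s = 0) \<or> (\<forall>s\<in>halfplane \<rho>. f s \<noteq> 0))"
proof (cases "\<exists>m\<ge>1. \<exists>n\<ge>1. a m n \<noteq> 0")
  case False
  then have "ds_kernel a s u = 0" for s u by (intro ds_kernel_zero) blast
  moreover have "is_dirichlet_series_on \<rho> (\<lambda>_. 0)"
    unfolding is_dirichlet_series_on_def by (intro exI[of _ "\<lambda>_. 0"]) simp
  ultimately show ?thesis by (intro exI[of _ "\<lambda>_. 0"]) simp
next
  case True
  let ?H = "halfplane \<rho>"
  define \<kappa> where "\<kappa> = ds_kernel a"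
  have psd: "psd_kernel ?H \<kappa>" using qi unfolding quasi_invariant_def \<kappa>_def by blast
  obtain m0 where m0: "m0 \<ge> 1" and corner: "a m0 m0 \<noteq> 0"
    and zero: "\<And>m n. 1 \<le> m \<Longrightarrow> 1 \<le> n \<Longrightarrow> m < m0 \<or> n < m0 \<Longrightarrow> a m n = 0"
    using ds_kernel_corner[OF ds psd[unfolded \<kappa>_def] True] by blast
  define \<delta> where "\<delta> = (\<lambda>(t::real) s. complex_of_real \<rho> + of_real t * (s - of_real \<rho>))"
  have inv: "J (\<delta> t) s * \<kappa> (\<delta> t s) (\<delta> t u) * cnj (J (\<delta> t) u) = \<kappa> s u"
    if "t > 0" "s \<in> ?H" "u \<in> ?H" for t s u
    using qi phi_dilation_in_Aut_L_H[OF that(1)] that(2,3)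
    unfolding quasi_invariant_def \<kappa>_def \<delta>_def by blast
  \<comment> \<open>The kernel along the dilations, rescaled by its leading power; the limit is the
    corner coefficient whatever \<open>s\<close> and \<open>u\<close> are.\<close>
  define E where "E = (\<lambda>s u t. of_nat m0 powr \<delta> t s * of_nat m0 powr cnj (\<delta> t u) * \<kappa> (\<delta> t s) (\<delta> t u))"
  have E_lim: "(E s u \<longlongrightarrow> a m0 m0) at_top" if s: "s \<in> ?H" and u: "u \<in> ?H" for s u
  proof -
    have "filterlim (\<lambda>t. Re (\<delta> t s)) at_top at_top" "filterlim (\<lambda>t. Re (cnj (\<delta> t u))) at_top at_top"
      using dilation_filterlim[OF s] dilation_filterlim[OF u] by (simp_all add: \<delta>_def)
    then show ?thesis unfolding E_def \<kappa>_def ds_kernel_def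
      by (intro double_dirichlet_leading_coefficient[OF ds _ m0 zero]) auto
  qed
  \<comment> \<open>Since \<open>J\<close> never vanishes, a zero on the diagonal would persist
    along the dilations and force the corner to be zero.\<close>
  have nz: "\<kappa> s s \<noteq> 0" if s: "s \<in> ?H" for s
  proof
    assume "\<kappa> s s = 0"
    have "\<forall>\<^sub>F t in at_top. E s s t = 0"
      using eventually_gt_at_top[of 0]
    proof eventually_elim
      case (elim t)
      have "J (\<delta> t) s \<noteq> 0"
        using qi phi_dilation_in_Aut_L_H[OF elim, of \<rho>] s unfolding quasi_invariant_def \<delta>_def by blast
      then show ?case using inv[OF elim s s] \<open>\<kappa> s s = 0\<close> by (simp add: E_def)
    qed
    with E_lim[OF s s] have "((\<lambda>t::real. 0) \<longlongrightarrow> a m0 m0) at_top"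
      by (rule Lim_transform_eventually)
    with corner show False by (simp add: tendsto_const_iff)
  qed
  \<comment> \<open>Invariance of the Cauchy-Schwarz ratio, in cross-multiplied form: the factors of
    \<open>J\<close> and the powers of \<open>m0\<close> agree on both sides, and the limit of every
    \<open>E\<close> is the same nonzero corner.\<close>
  have CS_eq: "(norm (\<kappa> s u))\<^sup>2 = norm (\<kappa> s s) * norm (\<kappa> u u)" if s: "s \<in> ?H" and u: "u \<in> ?H" for s u
  proof -
    have "\<forall>\<^sub>F t in at_top. (norm (\<kappa> s u))\<^sup>2 * (norm (E s s t) * norm (E u u t)) =
        (norm (E s u t))\<^sup>2 * (norm (\<kappa> s s) * norm (\<kappa> u u))"
      using eventually_gt_at_top[of 0]
    proof eventually_elim
      case (elim t)
      have "norm (E x y t) = real m0 powr Re (\<delta> t x) * real m0 powr Re (\<delta> t y) * norm (\<kappa> (\<delta> t x) (\<delta> t y))" for x y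
        unfolding E_def norm_mult norm_of_nat_powr[OF m0] by simp
      moreover have "norm (\<kappa> x y) = norm (J (\<delta> t) x) * norm (\<kappa> (\<delta> t x) (\<delta> t y)) * norm (J (\<delta> t) y)"
        if "x \<in> ?H" "y \<in> ?H" for x y
        using arg_cong[OF inv[OF elim that], of norm] by (simp add: norm_mult)
      ultimately show ?case using s u by (simp only: power2_eq_square mult_ac)
    qed
    moreover have "((\<lambda>t. (norm (\<kappa> s u))\<^sup>2 * (norm (E s s t) * norm (E u u t))) \<longlongrightarrow>
        (norm (\<kappa> s u))\<^sup>2 * (norm (a m0 m0) * norm (a m0 m0))) at_top"
      by (intro tendsto_intros E_lim s u)
    ultimately have "((\<lambda>t. (norm (E s u t))\<^sup>2 * (norm (\<kappa> s s) * norm (\<kappa> u u))) \<longlongrightarrow>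
        (norm (\<kappa> s u))\<^sup>2 * (norm (a m0 m0) * norm (a m0 m0))) at_top"
      by (rule Lim_transform_eventually[rotated])
    moreover have "((\<lambda>t. (norm (E s u t))\<^sup>2 * (norm (\<kappa> s s) * norm (\<kappa> u u))) \<longlongrightarrow>
        (norm (a m0 m0))\<^sup>2 * (norm (\<kappa> s s) * norm (\<kappa> u u))) at_top"
      by (intro tendsto_intros E_lim s u)
    ultimately have "(norm (\<kappa> s u))\<^sup>2 * (norm (a m0 m0) * norm (a m0 m0)) =
        (norm (a m0 m0))\<^sup>2 * (norm (\<kappa> s s) * norm (\<kappa> u u))"
      by (rule tendsto_unique[OF trivial_limit_at_top_linorder])
    with corner show ?thesis by (simp add: power2_eq_square)
  qed
  define v where "v = complex_of_real (\<rho> + 1)"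
  have v: "v \<in> ?H" by (simp add: v_def halfplane_def)
  define N where "N = Re (\<kappa> v v)"
  have vv: "\<kappa> v v = of_real N" unfolding N_def using psd_kernel_diag(1)[OF psd v] .
  have N: "N > 0" using psd_kernel_diag(2)[OF psd v] nz[OF v] vv unfolding N_def[symmetric]
    by (cases "N = 0") auto
  \<comment> \<open>Normalised so that \<open>f v * cnj (f v)\<close> equals
    \<open>\<kappa> v v\<close>. Its Dirichlet coefficients are the row sums at
    \<open>cnj v\<close>, divided by the same root.\<close>
  define f where "f = (\<lambda>s. \<kappa> s v / of_real (sqrt N))"
  have "is_dirichlet_series_on \<rho> f"
    unfolding is_dirichlet_series_on_def
  proof (intro exI[of _ "\<lambda>m. (\<Sum>j. a m (Suc j) * of_nat (Suc j) powr (- cnj v)) / of_real (sqrt N)"] ballI)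
    fix s assume s: "s \<in> ?H"
    have "regularly_convergent_at a s (cnj v)"
      using ds s cnj_halfplane[OF v] by (simp add: is_ds_kernel_on_def)
    from sums_divide[OF regularly_convergent_at_iterated[OF this], of "of_real (sqrt N)"]
    show "(\<lambda>k. (\<Sum>j. a (Suc k) (Suc j) * of_nat (Suc j) powr (- cnj v)) / of_real (sqrt N) *
        of_nat (Suc k) powr (- s)) sums f s"
      by (simp add: f_def \<kappa>_def ds_kernel_def)
  qed
  moreover have "ds_kernel a s u = f s * cnj (f u)" if s: "s \<in> ?H" and u: "u \<in> ?H" for s u
  proof -
    have "\<kappa> s u * of_real N = \<kappa> s v * cnj (\<kappa> u v)"
      using psd_kernel_rank_one[OF psd s u v nz[OF v] CS_eq[OF _ v]]
        psd_kernel_hermitian[OF psd u v] vv by simp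
    moreover have "complex_of_real (sqrt N) * of_real (sqrt N) = of_real N"
      using N by (simp flip: of_real_mult)
    ultimately show ?thesis using N by (simp add: f_def \<kappa>_def[symmetric] field_simps)
  qed
  moreover have "f s \<noteq> 0" if s: "s \<in> ?H" for s
    using CS_eq[OF s v] nz[OF s] nz[OF v] N by (auto simp: f_def)
  ultimately show ?thesis by blast
qed

section \<open>Assembling the equivalences\<close>

lemma is_dirichlet_series_on_scale:
  assumes "is_dirichlet_series_on \<rho> g"
  shows "is_dirichlet_series_on \<rho> (\<lambda>s. c * g s)"
proof -
  obtain b where "\<forall>s\<in>halfplane \<rho>. (\<lambda>k. b (Suc k) * of_nat (Suc k) powr (- s)) sums g s"
    using assms by (auto simp: is_dirichlet_series_on_def)
  then have "\<forall>s\<in>halfplane \<rho>. (\<lambda>k. (c * b (Suc k)) * of_nat (Suc k) powr (- s)) sums (c * g s)"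
    using sums_mult[of _ _ c] by (simp add: mult.assoc)
  then show ?thesis unfolding is_dirichlet_series_on_def
    by (intro exI[of _ "\<lambda>k. c * b k"]) simp
qed

theorem theorem4p2:
  fixes \<rho> :: real and a :: "nat \<Rightarrow> nat \<Rightarrow> complex"
  assumes "is_ds_kernel_on \<rho> a"
  shows "((\<exists>J. quasi_invariant (Aut_H \<rho>) (halfplane \<rho>) J (ds_kernel a))
            \<longleftrightarrow> (\<exists>J. quasi_invariant (Aut_L_H \<rho>) (halfplane \<rho>) J (ds_kernel a)))
       \<and> ((\<exists>J. quasi_invariant (Aut_L_H \<rho>) (halfplane \<rho>) J (ds_kernel a))
            \<longleftrightarrow> (\<exists>f. is_dirichlet_series_on \<rho> f \<and>
                     (\<forall>s\<in>halfplane \<rho>. \<forall>u\<in>halfplane \<rho>. ds_kernel a s u = f s * cnj (f u)) \<and>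
                     ((\<forall>s\<in>halfplane \<rho>. f s = 0) \<or> (\<forall>s\<in>halfplane \<rho>. f s \<noteq> 0))))
       \<and> ((\<exists>f. is_dirichlet_series_on \<rho> f \<and>
                     (\<forall>s\<in>halfplane \<rho>. \<forall>u\<in>halfplane \<rho>. ds_kernel a s u = f s * cnj (f u)) \<and>
                     ((\<forall>s\<in>halfplane \<rho>. f s = 0) \<or> (\<forall>s\<in>halfplane \<rho>. f s \<noteq> 0)))
            \<longleftrightarrow> (psd_kernel (halfplane \<rho>) (ds_kernel a) \<and>
                 (\<exists>H ip. is_RKHS (halfplane \<rho>) (ds_kernel a) H ip \<and>
                    (H = {\<lambda>s. 0} \<or>
                     (\<exists>g. is_dirichlet_series_on \<rho> g \<and> (\<forall>s\<in>halfplane \<rho>. g s \<noteq> 0) \<and>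
                          H = {restrict0 (halfplane \<rho>) (\<lambda>s. c * g s) | c. True})))))"
proof -
  let ?H = "halfplane \<rho>" and ?\<kappa> = "ds_kernel a"
  let ?iii = "\<exists>f. is_dirichlet_series_on \<rho> f \<and>
     (\<forall>s\<in>?H. \<forall>u\<in>?H. ?\<kappa> s u = f s * cnj (f u)) \<and> ((\<forall>s\<in>?H. f s = 0) \<or> (\<forall>s\<in>?H. f s \<noteq> 0))"
  let ?iv = "psd_kernel ?H ?\<kappa> \<and> (\<exists>H ip. is_RKHS ?H ?\<kappa> H ip \<and> (H = {\<lambda>s. 0} \<or>
     (\<exists>g. is_dirichlet_series_on \<rho> g \<and> (\<forall>s\<in>?H. g s \<noteq> 0) \<and>
        H = {restrict0 ?H (\<lambda>s. c * g s) | c. True})))"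
  \<comment> \<open>A base point in the half-plane, at which coefficients of multiples of one
    function are read off.\<close>
  define p where "p = complex_of_real (\<rho> + 1)"
  have p: "p \<in> ?H" by (simp add: p_def halfplane_def)
  have "Aut_L_H \<rho> \<subseteq> Aut_H \<rho>" unfolding Aut_L_H_def Aut_H_def by blast
  then have i_ii: "(\<exists>J. quasi_invariant (Aut_H \<rho>) ?H J ?\<kappa>) \<longrightarrow> (\<exists>J. quasi_invariant (Aut_L_H \<rho>) ?H J ?\<kappa>)"
    unfolding quasi_invariant_def by blast
  have ii_iii: "(\<exists>J. quasi_invariant (Aut_L_H \<rho>) ?H J ?\<kappa>) \<longrightarrow> ?iii"
    using rank_one_if_quasi_invariant_Aut_L_H[OF assms] by blast
  have iii_i: "?iii \<longrightarrow> (\<exists>J. quasi_invariant (Aut_H \<rho>) ?H J ?\<kappa>)"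
    using quasi_invariant_Aut_H_rank_one by blast
  have iii_iv: "?iii \<longrightarrow> ?iv"
  proof
    assume ?iii
    then obtain f where f: "is_dirichlet_series_on \<rho> f"
      "\<forall>s\<in>?H. \<forall>u\<in>?H. ?\<kappa> s u = f s * cnj (f u)"
      "(\<forall>s\<in>?H. f s = 0) \<or> (\<forall>s\<in>?H. f s \<noteq> 0)" by blast
    have "psd_kernel ?H ?\<kappa>" using f(2) by (intro psd_kernel_rank_one_form[of _ _ f]) blast
    moreover have "\<exists>H ip. is_RKHS ?H ?\<kappa> H ip \<and> (H = {\<lambda>s. 0} \<or>
       (\<exists>g. is_dirichlet_series_on \<rho> g \<and> (\<forall>s\<in>?H. g s \<noteq> 0) \<and>
        H = {restrict0 ?H (\<lambda>s. c * g s) | c. True}))"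
      using f(3)
    proof
      assume "\<forall>s\<in>?H. f s = 0"
      then have "is_RKHS ?H ?\<kappa> {\<lambda>s. 0} (\<lambda>_ _. 0)" using f(2) by (intro is_RKHS_zero) simp
      then show ?thesis by blast
    next
      assume nz: "\<forall>s\<in>?H. f s \<noteq> 0"
      from is_RKHS_rank_one[OF f(2) p] nz p f(1) show ?thesis by blast
    qed
    ultimately show ?iv by blast
  qed
  have iv_iii: "?iv \<longrightarrow> ?iii"
  proof
    assume ?iv
    then obtain H ip where psd: "psd_kernel ?H ?\<kappa>" and R: "is_RKHS ?H ?\<kappa> H ip"
      and H: "H = {\<lambda>s. 0} \<or> (\<exists>g. is_dirichlet_series_on \<rho> g \<and> (\<forall>s\<in>?H. g s \<noteq> 0) \<and>
        H = {restrict0 ?H (\<lambda>s. c * g s) | c. True})" by blast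
    from H show ?iii
    proof
      assume H0: "H = {\<lambda>s. 0}"
      have "\<forall>t\<in>?H. restrict0 ?H (\<lambda>s. ?\<kappa> s t) \<in> H"
        using R unfolding is_RKHS_def by (elim conjE) assumption
      then have "\<forall>s\<in>?H. \<forall>u\<in>?H. ?\<kappa> s u = 0"
        unfolding H0 by (auto simp: restrict0_def fun_eq_iff split: if_splits)
      moreover have "is_dirichlet_series_on \<rho> (\<lambda>_. 0)"
        unfolding is_dirichlet_series_on_def by (intro exI[of _ "\<lambda>_. 0"]) simp
      ultimately show ?iii by (intro exI[of _ "\<lambda>_. 0"]) simp
    next
      assume "\<exists>g. is_dirichlet_series_on \<rho> g \<and> (\<forall>s\<in>?H. g s \<noteq> 0) \<and>
        H = {restrict0 ?H (\<lambda>s. c * g s) | c. True}"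
      then obtain g where g: "is_dirichlet_series_on \<rho> g" "\<forall>s\<in>?H. g s \<noteq> 0"
        "H = {restrict0 ?H (\<lambda>s. c * g s) | c. True}" by blast
      obtain r where r: "\<forall>s\<in>?H. \<forall>u\<in>?H. ?\<kappa> s u = (of_real r * g s) * cnj (of_real r * g u)"
        using rank_one_if_is_RKHS_span[OF psd R[unfolded g(3)] p g(2)] by blast
      \<comment> \<open>If \<open>r = 0\<close> the kernel falls under the zero alternative; any
        other \<open>r\<close> keeps \<open>g\<close> nowhere vanishing.\<close>
      have "(\<forall>s\<in>?H. of_real r * g s = 0) \<or> (\<forall>s\<in>?H. of_real r * g s \<noteq> 0)"
        using g(2) by (cases "r = 0") auto
      with r is_dirichlet_series_on_scale[OF g(1), of "of_real r"] show ?iii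
        by (intro exI[of _ "\<lambda>s. of_real r * g s"]) blast
    qed
  qed
  \<comment> \<open>The first three conditions form a cycle, and the fourth is tied to the
    third.\<close>
  show ?thesis using i_ii ii_iii iii_i iii_iv iv_iii by argo
qed

end
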